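(* Let $(R,\mathfrak{m})$ be a complete Noetherian normal local ring of characteristic $p>0$ with residue field $k$ and $E=E_R(k)$, and let $I$ be an ideal satisfying $*\text{-core}_R(I)=I(J:_R I)$ for some $*$-reduction $J$ of $I$. Then $$*\text{-hull}^E(0:_E I)=\left(I\,(0:_E J):_E I\right),$$ i.e. $*\text{-hull}^E(0:_E I)$ is the $I$-basically full closure of $(0:_E J)$ in $E$.
   Context: $*$ denotes tight closure; $K^*$ is the tight closure of an ideal $K$ in $R$. A $*$-reduction of $I$ is an ideal $J\subseteq I$ with $J^*=I^*$; $*\text{-core}_R(I)$ is the intersection of all $*$-reductions of $I$. $E=E_R(k)$ is the injective hull of $k$ and $(-)^\vee=\mathrm{Hom}_R(-,E)$; by Matlis duality $E^\vee=R$, $R^\vee=E$, and for $A\subseteq E$, $(E/A)^\vee=(0:_R A)\subseteq R$. The interior operation dual to tight closure is given on submodules $A\subseteq E$ by $A^E_{*}:=\left(R/(0:_R A)^*\right)^\vee=0:_E(0:_R A)^*$. $*\text{-hull}^E(A)$ is the sum of all submodules $C$ with $A\subseteq C\subseteq E$ and $C^E_{*}=A^E_{*}$. For $L\subseteq M$ and an ideal $I$, $(L:_M I)=\{z\in M: Iz\subseteq L\}$, and the $I$-basically full closure of $L$ in $M$ is $(IL:_M I)$. *)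

theory Defs
  imports
    "HOL-Algebra.Module"
    "HOL-Algebra.QuotRing"
    "HOL-Algebra.Ideal_Product"
    "HOL-Algebra.Polynomials"
begin

section \<open>Complete normal local rings\<close>

definition local_ring :: "('r, 'm) ring_scheme \<Rightarrow> 'r set \<Rightarrow> bool" where
  "local_ring R \<mm> \<longleftrightarrow>
     cring R \<and> maximalideal \<mm> R \<and> (\<forall>\<nn>. maximalideal \<nn> R \<longrightarrow> \<nn> = \<mm>)"

text \<open>Powers of ideals are powers in the monoid \<^const>\<open>ideals_set\<close> of ideals, whose unit
  is the whole ring. Completeness includes separatedness.\<close>

definition adically_complete :: "('r, 'm) ring_scheme \<Rightarrow> 'r set \<Rightarrow> bool" where
  "adically_complete R I \<longleftrightarrow>
     (\<Inter>n. I [^]\<^bsub>ideals_set R\<^esub> (n::nat)) = {\<zero>\<^bsub>R\<^esub>} \<and>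
     (\<forall>x. (\<forall>n. x n \<in> carrier R) \<and>
          (\<forall>n::nat. \<exists>N::nat. \<forall>i\<ge>N. \<forall>j\<ge>N. x i \<ominus>\<^bsub>R\<^esub> x j \<in> I [^]\<^bsub>ideals_set R\<^esub> n) \<longrightarrow>
          (\<exists>y\<in>carrier R. \<forall>n::nat. \<exists>N::nat. \<forall>i\<ge>N. x i \<ominus>\<^bsub>R\<^esub> y \<in> I [^]\<^bsub>ideals_set R\<^esub> n))"

definition ring_char :: "('r, 'm) ring_scheme \<Rightarrow> nat" where
  "ring_char R =
     (if \<exists>n>0. add_pow R (n::nat) \<one>\<^bsub>R\<^esub> = \<zero>\<^bsub>R\<^esub>
      then LEAST n::nat. n > 0 \<and> add_pow R n \<one>\<^bsub>R\<^esub> = \<zero>\<^bsub>R\<^esub> else 0)"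

text \<open>\<open>frac_class R a b\<close> is the fraction \<open>a / b\<close>, i.e. the set of all pairs \<open>(c, d)\<close>
  with \<open>d \<noteq> 0\<close> and \<open>a d = c b\<close>. It is only meaningful over a domain.\<close>

definition frac_class :: "('r, 'm) ring_scheme \<Rightarrow> 'r \<Rightarrow> 'r \<Rightarrow> ('r \<times> 'r) set" where
  "frac_class R a b =
     {(c, d). c \<in> carrier R \<and> d \<in> carrier R - {\<zero>\<^bsub>R\<^esub>} \<and> a \<otimes>\<^bsub>R\<^esub> d = c \<otimes>\<^bsub>R\<^esub> b}"

definition fraction_field :: "('r, 'm) ring_scheme \<Rightarrow> ('r \<times> 'r) set ring" where
  "fraction_field R =
     \<lparr>carrier = {frac_class R a b | a b. a \<in> carrier R \<and> b \<in> carrier R - {\<zero>\<^bsub>R\<^esub>}},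
      monoid.mult = (\<lambda>U V. \<Union>{frac_class R (a \<otimes>\<^bsub>R\<^esub> c) (b \<otimes>\<^bsub>R\<^esub> d) | a b c d.
                  (a, b) \<in> U \<and> (c, d) \<in> V}),
      one = frac_class R \<one>\<^bsub>R\<^esub> \<one>\<^bsub>R\<^esub>,
      zero = frac_class R \<zero>\<^bsub>R\<^esub> \<one>\<^bsub>R\<^esub>,
      add = (\<lambda>U V. \<Union>{frac_class R ((a \<otimes>\<^bsub>R\<^esub> d) \<oplus>\<^bsub>R\<^esub> (c \<otimes>\<^bsub>R\<^esub> b)) (b \<otimes>\<^bsub>R\<^esub> d) | a b c d.
                  (a, b) \<in> U \<and> (c, d) \<in> V})\<rparr>"

definition integral_over :: "('k, 'm) ring_scheme \<Rightarrow> 'k set \<Rightarrow> 'k \<Rightarrow> bool" where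
  "integral_over K S x \<longleftrightarrow>
     (\<exists>p. p \<noteq> [] \<and> polynomial\<^bsub>K\<^esub> S p \<and> lead_coeff p = \<one>\<^bsub>K\<^esub> \<and> ring.eval K p x = \<zero>\<^bsub>K\<^esub>)"

text \<open>Integrally closed domains. A local ring that is normal in the sense that all its
  localizations at primes are integrally closed domains is itself such a domain, so for
  local rings this is the general notion of normality.\<close>

definition normal_domain :: "('r, 'm) ring_scheme \<Rightarrow> bool" where
  "normal_domain R \<longleftrightarrow> domain R \<and>
     (\<forall>x\<in>carrier (fraction_field R).
        integral_over (fraction_field R) ((\<lambda>r. frac_class R r \<one>\<^bsub>R\<^esub>) ` carrier R) x \<longrightarrow>
        x \<in> (\<lambda>r. frac_class R r \<one>\<^bsub>R\<^esub>) ` carrier R)"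

section \<open>Tight closure, \<open>*\<close>-reductions and the \<open>*\<close>-core\<close>

definition minimal_prime :: "'r set \<Rightarrow> ('r, 'm) ring_scheme \<Rightarrow> bool" where
  "minimal_prime P R \<longleftrightarrow>
     primeideal P R \<and> (\<forall>Q. primeideal Q R \<and> Q \<subseteq> P \<longrightarrow> Q = P)"

definition outside_minimal_primes :: "('r, 'm) ring_scheme \<Rightarrow> 'r set" where
  "outside_minimal_primes R = carrier R - \<Union>{P. minimal_prime P R}"

definition frobenius_power :: "('r, 'm) ring_scheme \<Rightarrow> 'r set \<Rightarrow> nat \<Rightarrow> 'r set" where
  "frobenius_power R I q = Idl\<^bsub>R\<^esub> {x [^]\<^bsub>R\<^esub> q | x. x \<in> I}"

text \<open>Meaningful for rings of prime characteristic: \<open>z\<close> lies in the tight closure of \<open>I\<close>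
  iff \<open>c z\<^sup>q \<in> I\<^sup>[\<^sup>q\<^sup>]\<close> for some \<open>c\<close> outside all minimal primes and all sufficiently
  large powers \<open>q\<close> of the characteristic.\<close>

definition tight_closure :: "('r, 'm) ring_scheme \<Rightarrow> 'r set \<Rightarrow> 'r set" where
  "tight_closure R I =
     {z \<in> carrier R. \<exists>c\<in>outside_minimal_primes R. \<exists>e0. \<forall>e\<ge>e0.
        c \<otimes>\<^bsub>R\<^esub> (z [^]\<^bsub>R\<^esub> (ring_char R ^ e)) \<in> frobenius_power R I (ring_char R ^ e)}"

definition star_reduction :: "('r, 'm) ring_scheme \<Rightarrow> 'r set \<Rightarrow> 'r set \<Rightarrow> bool" where
  "star_reduction R I J \<longleftrightarrow>
     ideal J R \<and> J \<subseteq> I \<and> tight_closure R J = tight_closure R I"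

definition star_core :: "('r, 'm) ring_scheme \<Rightarrow> 'r set \<Rightarrow> 'r set" where
  "star_core R I = \<Inter>{J. star_reduction R I J}"

section \<open>Submodules and colons\<close>

definition gen_submodule :: "('r, 'm) ring_scheme \<Rightarrow> ('r, 'e, 'n) module_scheme \<Rightarrow> 'e set \<Rightarrow> 'e set" where
  "gen_submodule R M S = \<Inter>{N. submodule N R M \<and> S \<subseteq> N}"

definition ideal_smult ::
  "('r, 'm) ring_scheme \<Rightarrow> ('r, 'e, 'n) module_scheme \<Rightarrow> 'r set \<Rightarrow> 'e set \<Rightarrow> 'e set" where
  "ideal_smult R M I L = gen_submodule R M {a \<odot>\<^bsub>M\<^esub> x | a x. a \<in> I \<and> x \<in> L}"

text \<open>The colons \<open>(J :\<^sub>R I)\<close>, \<open>(L :\<^sub>M I)\<close> and \<open>(0 :\<^sub>R A)\<close> for \<open>A \<subseteq> M\<close>, respectively.\<close>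

definition ideal_colon :: "('r, 'm) ring_scheme \<Rightarrow> 'r set \<Rightarrow> 'r set \<Rightarrow> 'r set" where
  "ideal_colon R J I = {r \<in> carrier R. \<forall>a\<in>I. a \<otimes>\<^bsub>R\<^esub> r \<in> J}"

definition module_colon :: "('r, 'e, 'n) module_scheme \<Rightarrow> 'e set \<Rightarrow> 'r set \<Rightarrow> 'e set" where
  "module_colon M L I = {z \<in> carrier M. \<forall>a\<in>I. a \<odot>\<^bsub>M\<^esub> z \<in> L}"

definition annihilator ::
  "('r, 'm) ring_scheme \<Rightarrow> ('r, 'e, 'n) module_scheme \<Rightarrow> 'e set \<Rightarrow> 'r set" where
  "annihilator R M A = {r \<in> carrier R. \<forall>x\<in>A. r \<odot>\<^bsub>M\<^esub> x = \<zero>\<^bsub>M\<^esub>}"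

definition basically_full_closure ::
  "('r, 'm) ring_scheme \<Rightarrow> ('r, 'e, 'n) module_scheme \<Rightarrow> 'r set \<Rightarrow> 'e set \<Rightarrow> 'e set" where
  "basically_full_closure R M I L = module_colon M (ideal_smult R M I L) I"

section \<open>Injective hulls\<close>

definition mod_hom ::
  "('r, 'm) ring_scheme \<Rightarrow> ('r, 'a, 'n) module_scheme \<Rightarrow> ('r, 'b, 'l) module_scheme \<Rightarrow> ('a \<Rightarrow> 'b) set" where
  "mod_hom R M N =
     {f \<in> carrier M \<rightarrow> carrier N.
        (\<forall>x\<in>carrier M. \<forall>y\<in>carrier M. f (x \<oplus>\<^bsub>M\<^esub> y) = f x \<oplus>\<^bsub>N\<^esub> f y) \<and>
        (\<forall>r\<in>carrier R. \<forall>x\<in>carrier M. f (r \<odot>\<^bsub>M\<^esub> x) = r \<odot>\<^bsub>N\<^esub> f x)}"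

text \<open>The test modules \<open>A \<subseteq> B\<close> have to be carried by a fixed type. We take \<open>'r + 'e\<close>, which
  is large enough for \<open>R\<close>, \<open>E\<close> and all their subquotients. By Baer's criterion the inclusions
  of ideals into \<open>R\<close> already suffice, so this is injectivity among all \<open>R\<close>-modules.\<close>

definition injective_module :: "('r, 'm) ring_scheme \<Rightarrow> ('r, 'e, 'n) module_scheme \<Rightarrow> bool" where
  "injective_module R E \<longleftrightarrow> module R E \<and>
     (\<forall>(A :: ('r, 'r + 'e) module) (B :: ('r, 'r + 'e) module) i f.
        module R A \<and> module R B \<and> i \<in> mod_hom R A B \<and> inj_on i (carrier A) \<and>
        f \<in> mod_hom R A E \<longrightarrow>
        (\<exists>g\<in>mod_hom R B E. \<forall>x\<in>carrier A. g (i x) = f x))"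

text \<open>\<open>E\<close> is an injective hull of \<open>M\<close>: an injective module with an essential embedding of \<open>M\<close>.\<close>

definition injective_hull ::
  "('r, 'm) ring_scheme \<Rightarrow> ('r, 'a, 'n) module_scheme \<Rightarrow> ('r, 'e, 'l) module_scheme \<Rightarrow> bool" where
  "injective_hull R M E \<longleftrightarrow> module R M \<and> injective_module R E \<and>
     (\<exists>\<iota>\<in>mod_hom R M E. inj_on \<iota> (carrier M) \<and>
        (\<forall>N. submodule N R E \<and> N \<noteq> {\<zero>\<^bsub>E\<^esub>} \<longrightarrow> N \<inter> \<iota> ` carrier M \<noteq> {\<zero>\<^bsub>E\<^esub>}))"

definition quot_module :: "('r, 'm) ring_scheme \<Rightarrow> 'r set \<Rightarrow> ('r, 'r set) module" where
  "quot_module R I =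
     ring.extend (R Quot I)
       \<lparr>smult = (\<lambda>r u. (I +>\<^bsub>R\<^esub> r) \<otimes>\<^bsub>R Quot I\<^esub> u)\<rparr>"

section \<open>The dual interior operation and the \<open>*\<close>-hull\<close>

text \<open>Evaluation at the class of \<open>1\<close> identifies \<open>Hom\<^sub>R(R/K, E)\<close> with \<open>(0 :\<^sub>E K)\<close>; the dual of
  \<open>R / (0 :\<^sub>R A)\<^sup>*\<close> is taken in this form, as a subset of \<open>E\<close>.\<close>

definition star_interior :: "('r, 'm) ring_scheme \<Rightarrow> ('r, 'e, 'n) module_scheme \<Rightarrow> 'e set \<Rightarrow> 'e set" where
  "star_interior R E A = module_colon E {\<zero>\<^bsub>E\<^esub>} (tight_closure R (annihilator R E A))"

definition star_hull :: "('r, 'm) ring_scheme \<Rightarrow> ('r, 'e, 'n) module_scheme \<Rightarrow> 'e set \<Rightarrow> 'e set" where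
  "star_hull R E A =
     gen_submodule R E
       (\<Union>{C. submodule C R E \<and> A \<subseteq> C \<and> star_interior R E C = star_interior R E A})"

end

theory Submission
  imports Defs "HOL-Algebra.Ring_Divisibility" "HOL-Computational_Algebra.Primes"
begin

text \<open>Let \<open>E\<close> be the injective hull of the residue field of a complete Noetherian local ring \<open>R\<close>.
  Then \<open>K \<mapsto> (0 :\<^sub>E K)\<close> and \<open>C \<mapsto> (0 :\<^sub>R C)\<close> are mutually inverse,
  inclusion-reversing bijections between the ideals of \<open>R\<close> and the submodules of \<open>E\<close>
  (\<open>annihilator_colon\<close> and \<open>colon_annihilator\<close>). Under this correspondence the submodules that
  define the star-hull of \<open>(0 :\<^sub>E I)\<close> are exactly the \<open>(0 :\<^sub>E K)\<close> with \<open>K\<close> a star-reduction of \<open>I\<close>: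
  the condition on interiors says \<open>(0 :\<^sub>E K\<^sup>*) = (0 :\<^sub>E I\<^sup>*)\<close>, and since tight closures are ideals
  this means \<open>K\<^sup>* = I\<^sup>*\<close>. Sums of submodules correspond to intersections of ideals, so the
  star-hull is dual to the star-core (\<open>star_hull_eq_dual_star_core\<close>). It remains to compute
  \<open>(0 :\<^sub>E I (J : I)) = ((0 :\<^sub>E (J : I)) :\<^sub>E I)\<close> and \<open>(0 :\<^sub>E (J : I)) = I (0 :\<^sub>E J)\<close>; the second
  identity holds because both sides have annihilator \<open>(J : I)\<close>.

  The correspondence itself comes from two facts. First, \<open>E\<close> is a cogenerator: for \<open>x \<notin> N \<subseteq> M\<close>
  the cyclic module \<open>(N + R x) / N\<close> maps onto \<open>k\<close>, and by injectivity this gives a map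
  \<open>M \<rightarrow> E\<close> that kills \<open>N\<close> but not \<open>x\<close>. With \<open>M = R\<close> this is \<open>annihilator_colon\<close>. Second, every
  endomorphism of \<open>E\<close> is multiplication by a ring element (\<open>hom_eq_smult\<close>), so that the
  cogenerator property with \<open>M = E\<close> yields \<open>colon_annihilator\<close>. To find the ring element, \<open>E\<close> is
  exhausted by the layers \<open>(0 :\<^sub>E \<mm>\<^sup>n)\<close>. The multiplier is found on one layer at a time, because
  the generators of \<open>\<mm>\<^sup>n\<close> send layer \<open>n + 1\<close> into the one-dimensional socle; the multipliers of
  the layers form a Cauchy sequence, and completeness supplies their limit.\<close>

section \<open>Submodules, colons and annihilators\<close>

lemma mod_homD:
  assumes "f \<in> mod_hom R M N"
  shows "x \<in> carrier M \<Longrightarrow> f x \<in> carrier N"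
    and "x \<in> carrier M \<Longrightarrow> y \<in> carrier M \<Longrightarrow> f (x \<oplus>\<^bsub>M\<^esub> y) = f x \<oplus>\<^bsub>N\<^esub> f y"
    and "r \<in> carrier R \<Longrightarrow> x \<in> carrier M \<Longrightarrow> f (r \<odot>\<^bsub>M\<^esub> x) = r \<odot>\<^bsub>N\<^esub> f x"
  using assms by (auto simp: mod_hom_def)

lemma mod_hom_zero:
  assumes "module R M" "module R N" "f \<in> mod_hom R M N"
  shows "f \<zero>\<^bsub>M\<^esub> = \<zero>\<^bsub>N\<^esub>"
proof -
  interpret M: module R M by fact
  interpret N: module R N by fact
  have "f \<zero>\<^bsub>M\<^esub> = f (\<zero>\<^bsub>R\<^esub> \<odot>\<^bsub>M\<^esub> \<zero>\<^bsub>M\<^esub>)" by simp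
  also have "\<dots> = \<zero>\<^bsub>R\<^esub> \<odot>\<^bsub>N\<^esub> f \<zero>\<^bsub>M\<^esub>" by (rule mod_homD(3)[OF assms(3)]) auto
  finally show ?thesis using mod_homD(1)[OF assms(3)] by simp
qed

context module
begin

lemma submodule_zero: "submodule N R M \<Longrightarrow> \<zero>\<^bsub>M\<^esub> \<in> N"
  using submodule.axioms(1) subgroup.one_closed by fastforce

lemma submodule_minus:
  assumes "submodule N R M" "x \<in> N" "y \<in> N"
  shows "x \<ominus>\<^bsub>M\<^esub> y \<in> N"
  using submoduleE(3,5)[OF assms(1)] assms(2,3) by (simp add: a_minus_def)

lemma minus_eq_zero_iff:
  assumes "x \<in> carrier M" "y \<in> carrier M"
  shows "x \<ominus>\<^bsub>M\<^esub> y = \<zero>\<^bsub>M\<^esub> \<longleftrightarrow> x = y"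
  using assms M.add.inv_solve_right'[of "\<zero>\<^bsub>M\<^esub>" x y] by (auto simp: M.minus_eq a_inv_def)

lemma smult_minus_distr:
  assumes "a \<in> carrier R" "b \<in> carrier R" "x \<in> carrier M"
  shows "(a \<ominus> b) \<odot>\<^bsub>M\<^esub> x = a \<odot>\<^bsub>M\<^esub> x \<ominus>\<^bsub>M\<^esub> b \<odot>\<^bsub>M\<^esub> x"
  using assms by (simp add: a_minus_def smult_l_distr smult_l_minus)

lemma cyclic_submodule:
  assumes "x \<in> carrier M"
  shows "submodule {s \<odot>\<^bsub>M\<^esub> x | s. s \<in> carrier R} R M"
proof (rule submoduleI)
  show "\<zero>\<^bsub>M\<^esub> \<in> {s \<odot>\<^bsub>M\<^esub> x | s. s \<in> carrier R}"
    using smult_l_null[OF assms] by force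
next
  fix a assume "a \<in> {s \<odot>\<^bsub>M\<^esub> x | s. s \<in> carrier R}"
  then obtain s where "s \<in> carrier R" "a = s \<odot>\<^bsub>M\<^esub> x" by blast
  then show "\<ominus>\<^bsub>M\<^esub> a \<in> {s \<odot>\<^bsub>M\<^esub> x | s. s \<in> carrier R}"
    using smult_l_minus[of s x] assms by (auto intro!: exI[of _ "\<ominus> s"])
next
  fix a b assume "a \<in> {s \<odot>\<^bsub>M\<^esub> x | s. s \<in> carrier R}" "b \<in> {s \<odot>\<^bsub>M\<^esub> x | s. s \<in> carrier R}"
  then obtain s t where "s \<in> carrier R" "a = s \<odot>\<^bsub>M\<^esub> x" "t \<in> carrier R" "b = t \<odot>\<^bsub>M\<^esub> x" by blast
  then show "a \<oplus>\<^bsub>M\<^esub> b \<in> {s \<odot>\<^bsub>M\<^esub> x | s. s \<in> carrier R}"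
    using smult_l_distr[of s t x] assms by (auto intro!: exI[of _ "s \<oplus> t"])
next
  fix a b assume "a \<in> carrier R" "b \<in> {s \<odot>\<^bsub>M\<^esub> x | s. s \<in> carrier R}"
  then obtain s where "a \<in> carrier R" "s \<in> carrier R" "b = s \<odot>\<^bsub>M\<^esub> x" by blast
  then show "a \<odot>\<^bsub>M\<^esub> b \<in> {s \<odot>\<^bsub>M\<^esub> x | s. s \<in> carrier R}"
    using smult_assoc1[of a s x] assms by (auto intro!: exI[of _ "a \<otimes> s"])
qed (use assms in auto)

lemma submodule_colon:
  assumes "submodule L R M" "S \<subseteq> carrier R"
  shows "submodule (module_colon M L S) R M"
proof (rule submoduleI)
  show "module_colon M L S \<subseteq> carrier M" by (auto simp: module_colon_def)
  show "\<zero>\<^bsub>M\<^esub> \<in> module_colon M L S"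
    using assms submodule_zero by (auto simp: module_colon_def)
  fix a assume a: "a \<in> module_colon M L S"
  then show "\<ominus>\<^bsub>M\<^esub> a \<in> module_colon M L S"
    using assms submoduleE(3)[OF assms(1)]
    by (auto simp: module_colon_def smult_r_minus subset_iff)
  fix b assume "b \<in> module_colon M L S"
  with a show "a \<oplus>\<^bsub>M\<^esub> b \<in> module_colon M L S"
    using assms submoduleE(5)[OF assms(1)]
    by (auto simp: module_colon_def smult_r_distr subset_iff)
next
  fix r x assume r: "r \<in> carrier R" and x: "x \<in> module_colon M L S"
  have "s \<odot>\<^bsub>M\<^esub> (r \<odot>\<^bsub>M\<^esub> x) = r \<odot>\<^bsub>M\<^esub> (s \<odot>\<^bsub>M\<^esub> x)" if "s \<in> S" for s
    using that r x assms(2) smult_assoc1 R.m_comm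
    by (metis (no_types, lifting) mem_Collect_eq module_colon_def subsetD)
  then show "r \<odot>\<^bsub>M\<^esub> x \<in> module_colon M L S"
    using r x submoduleE(4)[OF assms(1)] by (auto simp: module_colon_def)
qed

lemma zero_submodule: "submodule {\<zero>\<^bsub>M\<^esub>} R M"
  by (rule submoduleI) auto

lemma ideal_annihilator:
  assumes "A \<subseteq> carrier M"
  shows "ideal (annihilator R M A) R"
proof (rule idealI)
  show "ring R" by (rule R.ring_axioms)
  show "subgroup (annihilator R M A) (add_monoid R)"
    using assms
    by (intro R.add.subgroupI)
      (auto simp: annihilator_def smult_l_distr smult_l_minus subset_iff
        simp flip: a_inv_def intro: exI[of _ \<zero>])
  fix a r assume "a \<in> annihilator R M A" "r \<in> carrier R"
  then show "r \<otimes> a \<in> annihilator R M A" "a \<otimes> r \<in> annihilator R M A"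
    using assms by (auto simp: annihilator_def smult_assoc1 subset_iff R.m_comm[of a r])
qed

lemma colon_antimono: "K \<subseteq> L \<Longrightarrow> module_colon M N L \<subseteq> module_colon M N K"
  by (auto simp: module_colon_def)

lemma annihilator_antimono: "A \<subseteq> B \<Longrightarrow> annihilator R M B \<subseteq> annihilator R M A"
  by (auto simp: annihilator_def)

lemma colon_ideal_prod:
  assumes I: "ideal I R" and K: "ideal K R"
  shows "module_colon M {\<zero>\<^bsub>M\<^esub>} (I \<cdot> K) = module_colon M (module_colon M {\<zero>\<^bsub>M\<^esub>} K) I"
proof
  show "module_colon M {\<zero>\<^bsub>M\<^esub>} (I \<cdot> K) \<subseteq> module_colon M (module_colon M {\<zero>\<^bsub>M\<^esub>} K) I"
  proof
    fix z assume z: "z \<in> module_colon M {\<zero>\<^bsub>M\<^esub>} (I \<cdot> K)"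
    then have zM: "z \<in> carrier M" by (simp add: module_colon_def)
    have "b \<odot>\<^bsub>M\<^esub> (a \<odot>\<^bsub>M\<^esub> z) = \<zero>\<^bsub>M\<^esub>" if "a \<in> I" "b \<in> K" for a b
    proof -
      have "a \<otimes> b \<in> I \<cdot> K" using that by (rule ideal_prod.prod)
      then have "(a \<otimes> b) \<odot>\<^bsub>M\<^esub> z = \<zero>\<^bsub>M\<^esub>" using z by (simp add: module_colon_def)
      then show ?thesis
        using that ideal.Icarr[OF I] ideal.Icarr[OF K] zM
        by (simp add: R.m_comm flip: smult_assoc1)
    qed
    then show "z \<in> module_colon M (module_colon M {\<zero>\<^bsub>M\<^esub>} K) I"
      using zM ideal.Icarr[OF I] by (simp add: module_colon_def)
  qed
  show "module_colon M (module_colon M {\<zero>\<^bsub>M\<^esub>} K) I \<subseteq> module_colon M {\<zero>\<^bsub>M\<^esub>} (I \<cdot> K)"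
  proof
    fix z assume z: "z \<in> module_colon M (module_colon M {\<zero>\<^bsub>M\<^esub>} K) I"
    then have zM: "z \<in> carrier M" by (simp add: module_colon_def)
    have "s \<odot>\<^bsub>M\<^esub> z = \<zero>\<^bsub>M\<^esub>" if "s \<in> I \<cdot> K" for s
      using that
    proof induction
      case (prod a b)
      then have "b \<odot>\<^bsub>M\<^esub> (a \<odot>\<^bsub>M\<^esub> z) = \<zero>\<^bsub>M\<^esub>" using z by (simp add: module_colon_def)
      then show ?case
        using prod ideal.Icarr[OF I] ideal.Icarr[OF K] zM
        by (simp add: R.m_comm flip: smult_assoc1)
    next
      case (sum s s')
      then have "s \<in> carrier R" "s' \<in> carrier R"
        using R.ideal_prod_in_carrier[OF I K] by blast+
      with sum show ?case using zM by (simp add: smult_l_distr)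
    qed
    then show "z \<in> module_colon M {\<zero>\<^bsub>M\<^esub>} (I \<cdot> K)" using zM by (simp add: module_colon_def)
  qed
qed

lemma gen_submodule_subset: "submodule N R M \<Longrightarrow> S \<subseteq> N \<Longrightarrow> gen_submodule R M S \<subseteq> N"
  by (auto simp: gen_submodule_def)

lemma subset_gen_submodule: "S \<subseteq> gen_submodule R M S"
  by (auto simp: gen_submodule_def)

lemma submodule_gen_submodule:
  assumes "S \<subseteq> carrier M"
  shows "submodule (gen_submodule R M S) R M"
proof (rule submoduleI)
  show "gen_submodule R M S \<subseteq> carrier M"
    using assms carrier_is_submodule gen_submodule_subset by blast
qed (auto simp: gen_submodule_def submodule_zero submoduleE)

end

context cring
begin

lemma ideal_ideal_colon:
  assumes J: "ideal J R" and I: "ideal I R"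
  shows "ideal (ideal_colon R J I) R"
proof (rule idealI)
  show "ring R" by (rule ring_axioms)
  note Icarr = ideal.Icarr[OF I]
  note J_closed = ideal.I_l_closed[OF J] additive_subgroup.a_closed[OF ideal.axioms(1)[OF J]]
    additive_subgroup.zero_closed[OF ideal.axioms(1)[OF J]]
    additive_subgroup.a_inv_closed[OF ideal.axioms(1)[OF J]]
  show "subgroup (ideal_colon R J I) (add_monoid R)"
    using Icarr J_closed
    by (intro add.subgroupI)
      (auto simp: ideal_colon_def r_distr r_minus simp flip: a_inv_def intro: exI[of _ \<zero>])
  fix a r assume a: "a \<in> ideal_colon R J I" and r: "r \<in> carrier R"
  then show "r \<otimes> a \<in> ideal_colon R J I"
    using Icarr J_closed(1)
    by (auto simp: ideal_colon_def m_lcomm[of _ r a])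
  then show "a \<otimes> r \<in> ideal_colon R J I"
    using a r by (simp add: ideal_colon_def m_comm)
qed

end

section \<open>Extending homomorphisms into an injective module\<close>

text \<open>Injectivity speaks only of test modules carried by \<open>'r + 'e\<close>. A module \<open>M\<close> on another type is
  moved there along an injection \<open>j\<close> of types; \<open>j\<close> will be \<^const>\<open>Inl\<close> for \<open>M = R\<close> and \<^const>\<open>Inr\<close>
  for \<open>M = E\<close>.\<close>
lemma injective_extend:
  fixes R :: "('r, 'm) ring_scheme" and E :: "('r, 'e, 'n) module_scheme"
    and M :: "('r, 'a, 'x) module_scheme" and j :: "'a \<Rightarrow> 'r + 'e"
  assumes inj_E: "injective_module R E" and M: "module R M" and j: "inj j"
    and N: "submodule N R M" and f: "f \<in> mod_hom R (M\<lparr>carrier := N\<rparr>) E"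
  shows "\<exists>g\<in>mod_hom R M E. \<forall>x\<in>N. g x = f x"
proof -
  interpret M: module R M by fact
  define k where "k = inv_into UNIV j"
  \<comment> \<open>The ring multiplication and unit that the record type demands are arbitrary.\<close>
  define copy :: "'a set \<Rightarrow> ('r, 'r + 'e) module" where
    "copy D = \<lparr>carrier = j ` D, monoid.mult = (\<lambda>x y. x), one = j \<zero>\<^bsub>M\<^esub>, zero = j \<zero>\<^bsub>M\<^esub>,
       add = (\<lambda>x y. j (k x \<oplus>\<^bsub>M\<^esub> k y)), smult = (\<lambda>r y. j (r \<odot>\<^bsub>M\<^esub> k y))\<rparr>" for D
  have inv_j [simp]: "k (j x) = x" for x
    using j by (simp add: k_def)
  have copy_module: "module R (copy D)" if D: "submodule D R M" for D
  proof (rule moduleI)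
    have D_sub: "x \<in> carrier M" if "x \<in> D" for x
      using M.submoduleE(1)[OF D] that by blast
    note D_closed = M.submodule_zero[OF D] M.submoduleE(3-5)[OF D]
    show "cring R" by (rule M.R.is_cring)
    show "abelian_group (copy D)"
    proof (rule abelian_groupI)
      fix x assume "x \<in> carrier (copy D)"
      then obtain d where "d \<in> D" "x = j d" by (auto simp: copy_def)
      then show "\<exists>y\<in>carrier (copy D). y \<oplus>\<^bsub>copy D\<^esub> x = \<zero>\<^bsub>copy D\<^esub>"
        using D_closed D_sub
        by (intro bexI[of _ "j (\<ominus>\<^bsub>M\<^esub> d)"]) (auto simp: copy_def M.M.l_neg)
    qed (use D_closed D_sub in \<open>auto simp: copy_def M.M.a_ac\<close>)
  qed (use M.submoduleE(1)[OF D] M.submoduleE(4,5)[OF D] in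
      \<open>auto simp: copy_def subset_iff M.smult_l_distr M.smult_r_distr M.smult_assoc1\<close>)
  have id: "id \<in> mod_hom R (copy N) (copy (carrier M))"
    using M.submoduleE(1)[OF N] by (auto simp: mod_hom_def copy_def)
  have f': "f \<circ> k \<in> mod_hom R (copy N) E"
    using f M.submoduleE(4,5)[OF N] by (auto simp: mod_hom_def copy_def)
  have "\<exists>g\<in>mod_hom R (copy (carrier M)) E. \<forall>x\<in>carrier (copy N). g (id x) = (f \<circ> k) x"
    using inj_E copy_module[OF N] copy_module[OF M.carrier_is_submodule] id f'
    unfolding injective_module_def by (metis inj_on_id)
  then obtain g where g: "g \<in> mod_hom R (copy (carrier M)) E"
    and gf: "\<And>x. x \<in> N \<Longrightarrow> g (j x) = f x"
    by (auto simp: copy_def)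
  have "g \<circ> j \<in> mod_hom R M E"
    using mod_homD[OF g] by (auto simp: mod_hom_def copy_def Pi_iff) (metis inv_j imageI)+
  with gf show ?thesis by (intro bexI[of _ "g \<circ> j"]) auto
qed

section \<open>The injective hull of the residue field\<close>

context noetherian_ring
begin

text \<open>The maximal condition, obtained from the chain condition by Zorn's lemma.\<close>
lemma maximal_in_family:
  assumes "\<F> \<noteq> {}" "\<And>L. L \<in> \<F> \<Longrightarrow> ideal L R"
  shows "\<exists>L\<in>\<F>. \<forall>L'\<in>\<F>. L \<subseteq> L' \<longrightarrow> L' = L"
proof (rule subset_Zorn)
  fix C assume C: "subset.chain \<F> C"
  show "\<exists>U\<in>\<F>. \<forall>V\<in>C. V \<subseteq> U"
  proof (cases "C = {}")
    case True then show ?thesis using assms(1) by auto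
  next
    case False
    have "subset.chain {I. ideal I R} C"
      using C assms(2) by (auto simp: pred_on.chain_def)
    then have "\<Union>C \<in> C" using ideal_chain_is_trivial[OF False] by blast
    then show ?thesis using C by (auto simp: pred_on.chain_def)
  qed
qed

lemma proper_ideal_subset_max:
  assumes local: "local_ring R \<mm>" and "ideal K R" "\<one> \<notin> K"
  shows "K \<subseteq> \<mm>"
proof -
  define \<F> where "\<F> = {L. ideal L R \<and> K \<subseteq> L \<and> \<one> \<notin> L}"
  have "\<exists>L\<in>\<F>. \<forall>L'\<in>\<F>. L \<subseteq> L' \<longrightarrow> L' = L"
    by (rule maximal_in_family) (use assms(2,3) in \<open>auto simp: \<F>_def\<close>)
  then obtain L where L: "ideal L R" "K \<subseteq> L" "\<one> \<notin> L"
    and L_max: "\<And>L'. L' \<in> \<F> \<Longrightarrow> L \<subseteq> L' \<Longrightarrow> L' = L"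
    by (auto simp: \<F>_def)
  have "maximalideal L R"
  proof (rule maximalidealI)
    show "carrier R \<noteq> L" using L(3) by auto
    fix L' assume L': "ideal L' R" "L \<subseteq> L'" "L' \<subseteq> carrier R"
    show "L' = L \<or> L' = carrier R"
      using L_max[of L'] L' L(2) ideal.one_imp_carrier[OF L'(1)]
      by (cases "\<one> \<in> L'") (auto simp: \<F>_def)
  qed (rule L(1))
  then show ?thesis using local L(2) by (auto simp: local_ring_def)
qed

lemma unit_of_notin_max:
  assumes local: "local_ring R \<mm>" and s: "s \<in> carrier R" "s \<notin> \<mm>"
  shows "\<exists>t\<in>carrier R. t \<otimes> s = \<one>"
proof -
  have "cring R" using local by (simp add: local_ring_def)
  have "\<one> \<in> PIdl s"
    using proper_ideal_subset_max[OF local cring.cgenideal_ideal[OF \<open>cring R\<close> s(1)]]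
      cgenideal_self[OF s(1)] s(2) by blast
  then show ?thesis by (auto simp: cgenideal_def)
qed

end

text \<open>\<open>u\<close> is the image of \<open>1 \<in> k\<close> in \<open>E\<close>. That \<open>k \<rightarrow> E\<close> is an essential embedding is recorded as: \<open>u\<close>
  is nonzero, \<open>\<mm>\<close> kills it, and it lies in every nonzero submodule. Since \<open>k\<close> is simple, a
  submodule that meets \<open>R u\<close> nontrivially contains \<open>u\<close>, so this loses nothing.\<close>
locale residue_hull = module R E + noetherian_ring R
  for R :: "('r, 'm) ring_scheme" (structure) and E :: "('r, 'e, 'n) module_scheme" (structure) +
  fixes \<mm> :: "'r set" and u :: 'e
  assumes local: "local_ring R \<mm>"
    and complete: "adically_complete R \<mm>"
    and injective: "injective_module R E"
    and u_closed [simp, intro]: "u \<in> carrier E"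
    and u_nonzero: "u \<noteq> \<zero>\<^bsub>E\<^esub>"
    and max_u: "a \<in> \<mm> \<Longrightarrow> a \<odot>\<^bsub>E\<^esub> u = \<zero>\<^bsub>E\<^esub>"
    and u_essential: "submodule N R E \<Longrightarrow> N \<noteq> {\<zero>\<^bsub>E\<^esub>} \<Longrightarrow> u \<in> N"
begin

lemma max_ideal: "ideal \<mm> R"
  using local maximalideal.axioms(1) by (auto simp: local_ring_def)

lemma max_carrier: "a \<in> \<mm> \<Longrightarrow> a \<in> carrier R"
  using ideal.Icarr[OF max_ideal] .

lemma u_multiple:
  assumes "z \<in> carrier E" "z \<noteq> \<zero>\<^bsub>E\<^esub>"
  shows "\<exists>s\<in>carrier R. s \<odot>\<^bsub>E\<^esub> z = u"
proof -
  have "z \<in> {s \<odot>\<^bsub>E\<^esub> z | s. s \<in> carrier R}" using assms by (auto intro!: exI[of _ \<one>])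
  then have "u \<in> {s \<odot>\<^bsub>E\<^esub> z | s. s \<in> carrier R}"
    using u_essential[OF cyclic_submodule[OF assms(1)]] assms(2) by blast
  then show ?thesis by blast
qed

text \<open>The socle \<open>(0 :\<^sub>E \<mm>)\<close> is the line spanned by \<open>u\<close>: a nonzero \<open>z\<close> has \<open>u\<close> as a multiple \<open>s z\<close>, and \<open>s\<close>
  must be a unit because elements of \<open>\<mm>\<close> kill \<open>z\<close>.\<close>
lemma socle:
  assumes z: "z \<in> carrier E" and kill: "\<And>a. a \<in> \<mm> \<Longrightarrow> a \<odot>\<^bsub>E\<^esub> z = \<zero>\<^bsub>E\<^esub>"
  shows "\<exists>t\<in>carrier R. z = t \<odot>\<^bsub>E\<^esub> u"
proof (cases "z = \<zero>\<^bsub>E\<^esub>")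
  case True then show ?thesis by (intro bexI[of _ \<zero>]) auto
next
  case False
  then obtain s where s: "s \<in> carrier R" "s \<odot>\<^bsub>E\<^esub> z = u" using u_multiple z by blast
  then have "s \<notin> \<mm>" using kill u_nonzero by auto
  then obtain t where "t \<in> carrier R" "t \<otimes> s = \<one>" using unit_of_notin_max[OF local] s by blast
  then have "z = t \<odot>\<^bsub>E\<^esub> u" using s z by (metis smult_assoc1 smult_one)
  with \<open>t \<in> carrier R\<close> show ?thesis by blast
qed

text \<open>The map \<open>n + s x \<mapsto> s u\<close> on \<open>N + R x\<close> is well defined because \<open>{s. s x \<in> N}\<close> is a proper ideal and
  hence lies in \<open>\<mm>\<close>, which kills \<open>u\<close>. By injectivity it extends to all of \<open>M\<close>.\<close>
lemma cogenerator:
  fixes M :: "('r, 'a, 'x) module_scheme" and j :: "'a \<Rightarrow> 'r + 'e"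
  assumes M: "module R M" and j: "inj j"
    and N: "submodule N R M" and x: "x \<in> carrier M" "x \<notin> N"
  shows "\<exists>g\<in>mod_hom R M E. (\<forall>y\<in>N. g y = \<zero>\<^bsub>E\<^esub>) \<and> g x = u"
proof -
  interpret M: module R M by fact
  have N_sub: "y \<in> carrier M" if "y \<in> N" for y
    using M.submoduleE(1)[OF N] that by blast
  note N_closed = M.submoduleE(3-5)[OF N] M.submodule_zero[OF N]
  have "ideal {s \<in> carrier R. s \<odot>\<^bsub>M\<^esub> x \<in> N} R"
  proof (rule idealI)
    show "ring R" by (rule R.ring_axioms)
    show "subgroup {s \<in> carrier R. s \<odot>\<^bsub>M\<^esub> x \<in> N} (add_monoid R)"
      using x N_closed
      by (intro R.add.subgroupI)
        (auto simp: M.smult_l_distr M.smult_l_minus simp flip: a_inv_def intro: exI[of _ \<zero>])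
    fix a r assume "a \<in> {s \<in> carrier R. s \<odot>\<^bsub>M\<^esub> x \<in> N}" "r \<in> carrier R"
    then show "r \<otimes> a \<in> {s \<in> carrier R. s \<odot>\<^bsub>M\<^esub> x \<in> N}" "a \<otimes> r \<in> {s \<in> carrier R. s \<odot>\<^bsub>M\<^esub> x \<in> N}"
      using x N_closed by (auto simp: M.smult_assoc1 R.m_comm[of a r])
  qed
  moreover have "\<one> \<notin> {s \<in> carrier R. s \<odot>\<^bsub>M\<^esub> x \<in> N}" using x by simp
  ultimately have colon_max: "s \<in> \<mm>" if "s \<in> carrier R" "s \<odot>\<^bsub>M\<^esub> x \<in> N" for s
    using proper_ideal_subset_max[OF local] that by blast
  define D where "D = {n \<oplus>\<^bsub>M\<^esub> s \<odot>\<^bsub>M\<^esub> x | n s. n \<in> N \<and> s \<in> carrier R}"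
  \<comment> \<open>The value of f at y uses a chosen coefficient of x; by f_eq below the choice is immaterial.\<close>
  define f where "f y = (SOME s. s \<in> carrier R \<and> (\<exists>n\<in>N. y = n \<oplus>\<^bsub>M\<^esub> s \<odot>\<^bsub>M\<^esub> x)) \<odot>\<^bsub>E\<^esub> u" for y
  have f_eq: "f (n \<oplus>\<^bsub>M\<^esub> s \<odot>\<^bsub>M\<^esub> x) = s \<odot>\<^bsub>E\<^esub> u" if n: "n \<in> N" and s: "s \<in> carrier R" for n s
  proof -
    define s' where "s' = (SOME s'. s' \<in> carrier R \<and> (\<exists>n'\<in>N. n \<oplus>\<^bsub>M\<^esub> s \<odot>\<^bsub>M\<^esub> x = n' \<oplus>\<^bsub>M\<^esub> s' \<odot>\<^bsub>M\<^esub> x))"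
    have "s' \<in> carrier R \<and> (\<exists>n'\<in>N. n \<oplus>\<^bsub>M\<^esub> s \<odot>\<^bsub>M\<^esub> x = n' \<oplus>\<^bsub>M\<^esub> s' \<odot>\<^bsub>M\<^esub> x)"
      unfolding s'_def by (rule someI[of _ s]) (use n s in blast)
    then obtain n' where s': "s' \<in> carrier R" and n': "n' \<in> N"
      and eq: "n \<oplus>\<^bsub>M\<^esub> s \<odot>\<^bsub>M\<^esub> x = n' \<oplus>\<^bsub>M\<^esub> s' \<odot>\<^bsub>M\<^esub> x" by blast
    have "(s' \<ominus> s) \<odot>\<^bsub>M\<^esub> x = s' \<odot>\<^bsub>M\<^esub> x \<ominus>\<^bsub>M\<^esub> s \<odot>\<^bsub>M\<^esub> x"
      using s s' x by (simp add: M.smult_minus_distr)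
    also have "\<dots> = n \<ominus>\<^bsub>M\<^esub> n'"
    proof -
      have c: "n \<in> carrier M" "n' \<in> carrier M" "s \<odot>\<^bsub>M\<^esub> x \<in> carrier M" "s' \<odot>\<^bsub>M\<^esub> x \<in> carrier M"
        using n n' N_sub s s' x by auto
      have "s' \<odot>\<^bsub>M\<^esub> x = \<ominus>\<^bsub>M\<^esub> n' \<oplus>\<^bsub>M\<^esub> (n \<oplus>\<^bsub>M\<^esub> s \<odot>\<^bsub>M\<^esub> x)"
        using c by (simp add: eq M.M.r_neg1)
      then show ?thesis using c by (simp add: a_minus_def M.M.a_ac M.M.r_neg2 M.M.r_neg)
    qed
    finally have "s' \<ominus> s \<in> \<mm>"
      using colon_max s s' M.submodule_minus[OF N n n'] by simp
    then have "(s' \<ominus> s) \<odot>\<^bsub>E\<^esub> u = \<zero>\<^bsub>E\<^esub>" by (rule max_u)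
    then have "s' \<odot>\<^bsub>E\<^esub> u \<ominus>\<^bsub>E\<^esub> s \<odot>\<^bsub>E\<^esub> u = \<zero>\<^bsub>E\<^esub>"
      using s s' by (simp add: smult_minus_distr)
    then have "s' \<odot>\<^bsub>E\<^esub> u = s \<odot>\<^bsub>E\<^esub> u"
      using s s' by (simp add: minus_eq_zero_iff)
    then show ?thesis by (simp add: f_def s'_def)
  qed
  have D_mem: "n \<oplus>\<^bsub>M\<^esub> s \<odot>\<^bsub>M\<^esub> x \<in> D" if "n \<in> N" "s \<in> carrier R" for n s
    using that by (auto simp: D_def)
  have D: "submodule D R M"
  proof (rule M.submoduleI)
    show "D \<subseteq> carrier M" using N_sub x by (auto simp: D_def)
    show "\<zero>\<^bsub>M\<^esub> \<in> D"
      using D_mem[of "\<zero>\<^bsub>M\<^esub>" \<zero>] N_closed x by simp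
  next
    fix a assume "a \<in> D"
    then obtain n s where "n \<in> N" "s \<in> carrier R" "a = n \<oplus>\<^bsub>M\<^esub> s \<odot>\<^bsub>M\<^esub> x" by (auto simp: D_def)
    moreover from this have "\<ominus>\<^bsub>M\<^esub> a = \<ominus>\<^bsub>M\<^esub> n \<oplus>\<^bsub>M\<^esub> (\<ominus> s) \<odot>\<^bsub>M\<^esub> x"
      using x N_sub by (simp add: M.smult_l_minus M.M.minus_add)
    ultimately show "\<ominus>\<^bsub>M\<^esub> a \<in> D" using N_closed by (simp add: D_mem)
  next
    fix a b assume "a \<in> D" "b \<in> D"
    then obtain n s n' s' where ns: "n \<in> N" "s \<in> carrier R" "a = n \<oplus>\<^bsub>M\<^esub> s \<odot>\<^bsub>M\<^esub> x"
      "n' \<in> N" "s' \<in> carrier R" "b = n' \<oplus>\<^bsub>M\<^esub> s' \<odot>\<^bsub>M\<^esub> x" by (auto simp: D_def)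
    moreover from this have "a \<oplus>\<^bsub>M\<^esub> b = (n \<oplus>\<^bsub>M\<^esub> n') \<oplus>\<^bsub>M\<^esub> (s \<oplus> s') \<odot>\<^bsub>M\<^esub> x"
      using x N_sub by (simp add: M.smult_l_distr M.M.a_ac)
    ultimately show "a \<oplus>\<^bsub>M\<^esub> b \<in> D" using N_closed by (simp add: D_mem)
  next
    fix r a assume r: "r \<in> carrier R" and "a \<in> D"
    then obtain n s where "n \<in> N" "s \<in> carrier R" "a = n \<oplus>\<^bsub>M\<^esub> s \<odot>\<^bsub>M\<^esub> x" by (auto simp: D_def)
    moreover from this have "r \<odot>\<^bsub>M\<^esub> a = r \<odot>\<^bsub>M\<^esub> n \<oplus>\<^bsub>M\<^esub> (r \<otimes> s) \<odot>\<^bsub>M\<^esub> x"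
      using x N_sub r by (simp add: M.smult_r_distr M.smult_assoc1)
    ultimately show "r \<odot>\<^bsub>M\<^esub> a \<in> D" using N_closed r by (simp add: D_mem)
  qed
  have "f \<in> mod_hom R (M\<lparr>carrier := D\<rparr>) E"
    unfolding mod_hom_def
  proof (intro CollectI conjI ballI)
    show "f \<in> carrier (M\<lparr>carrier := D\<rparr>) \<rightarrow> carrier E" by (auto simp: D_def f_eq)
  next
    fix a b assume "a \<in> carrier (M\<lparr>carrier := D\<rparr>)" "b \<in> carrier (M\<lparr>carrier := D\<rparr>)"
    then obtain n s n' s' where ns: "n \<in> N" "s \<in> carrier R" "a = n \<oplus>\<^bsub>M\<^esub> s \<odot>\<^bsub>M\<^esub> x"
      "n' \<in> N" "s' \<in> carrier R" "b = n' \<oplus>\<^bsub>M\<^esub> s' \<odot>\<^bsub>M\<^esub> x" by (auto simp: D_def)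
    moreover from this have "a \<oplus>\<^bsub>M\<^esub> b = (n \<oplus>\<^bsub>M\<^esub> n') \<oplus>\<^bsub>M\<^esub> (s \<oplus> s') \<odot>\<^bsub>M\<^esub> x"
      using x N_sub by (simp add: M.smult_l_distr M.M.a_ac)
    ultimately show "f (a \<oplus>\<^bsub>M\<lparr>carrier := D\<rparr>\<^esub> b) = f a \<oplus>\<^bsub>E\<^esub> f b"
      using N_closed by (simp add: f_eq smult_l_distr)
  next
    fix r a assume r: "r \<in> carrier R" and "a \<in> carrier (M\<lparr>carrier := D\<rparr>)"
    then obtain n s where "n \<in> N" "s \<in> carrier R" "a = n \<oplus>\<^bsub>M\<^esub> s \<odot>\<^bsub>M\<^esub> x" by (auto simp: D_def)
    moreover from this have "r \<odot>\<^bsub>M\<^esub> a = r \<odot>\<^bsub>M\<^esub> n \<oplus>\<^bsub>M\<^esub> (r \<otimes> s) \<odot>\<^bsub>M\<^esub> x"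
      using x N_sub r by (simp add: M.smult_r_distr M.smult_assoc1)
    ultimately show "f (r \<odot>\<^bsub>M\<lparr>carrier := D\<rparr>\<^esub> a) = r \<odot>\<^bsub>E\<^esub> f a"
      using N_closed r by (simp add: f_eq smult_assoc1)
  qed
  then obtain g where g: "g \<in> mod_hom R M E" and gf: "\<And>y. y \<in> D \<Longrightarrow> g y = f y"
    using injective_extend[OF injective M j D] by blast
  have "g y = \<zero>\<^bsub>E\<^esub>" if "y \<in> N" for y
  proof -
    have "y = y \<oplus>\<^bsub>M\<^esub> \<zero> \<odot>\<^bsub>M\<^esub> x" using that N_sub x by simp
    moreover from this have "y \<in> D" using D_mem[OF that R.zero_closed] by simp
    ultimately show ?thesis using gf f_eq[OF that R.zero_closed] by simp
  qed
  moreover have "g x = u"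
  proof -
    have "x = \<zero>\<^bsub>M\<^esub> \<oplus>\<^bsub>M\<^esub> \<one> \<odot>\<^bsub>M\<^esub> x" using x by simp
    moreover from this have "x \<in> D" using D_mem[of "\<zero>\<^bsub>M\<^esub>" \<one>] N_closed by simp
    ultimately show ?thesis using gf f_eq[of "\<zero>\<^bsub>M\<^esub>" \<one>] N_closed by simp
  qed
  ultimately show ?thesis using g by blast
qed

text \<open>For \<open>r \<notin> K\<close> a homomorphism \<open>g : R \<rightarrow> E\<close> with \<open>g K = 0\<close> and \<open>g r \<noteq> 0\<close> is multiplication of ring
  elements with \<open>g 1\<close>, so \<open>g 1\<close> lies in \<open>(0 :\<^sub>E K)\<close> and is not killed by \<open>r\<close>.\<close>
lemma annihilator_colon:
  assumes K: "ideal K R"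
  shows "annihilator R E (module_colon E {\<zero>\<^bsub>E\<^esub>} K) = K"
proof
  show "K \<subseteq> annihilator R E (module_colon E {\<zero>\<^bsub>E\<^esub>} K)"
    using ideal.Icarr[OF K] by (auto simp: annihilator_def module_colon_def)
  show "annihilator R E (module_colon E {\<zero>\<^bsub>E\<^esub>} K) \<subseteq> K"
  proof (rule subsetI, rule ccontr)
    fix r assume r: "r \<in> annihilator R E (module_colon E {\<zero>\<^bsub>E\<^esub>} K)" and rK: "r \<notin> K"
    \<comment> \<open>R as a module over itself; its submodules are the ideals of R.\<close>
    define M :: "('r, 'r) module" where
      "M = \<lparr>carrier = carrier R, monoid.mult = monoid.mult R, one = \<one>, zero = \<zero>,
        add = add R, smult = monoid.mult R\<rparr>"
    have M: "module R M"
    proof (rule moduleI)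
      show "cring R" by (rule R.is_cring)
      show "abelian_group M"
        by (rule abelian_groupI) (auto simp: M_def R.a_ac intro: bexI[of _ "\<ominus> _"] R.l_neg)
    qed (auto simp: M_def R.l_distr R.r_distr R.m_assoc)
    interpret M: module R M by (rule M)
    have "\<ominus>\<^bsub>M\<^esub> a = \<ominus> a" for a
      by (simp add: M_def a_inv_def m_inv_def)
    then have "submodule K R M"
      using ideal.Icarr[OF K] ideal.I_l_closed[OF K]
        additive_subgroup.a_closed[OF ideal.axioms(1)[OF K]]
        additive_subgroup.zero_closed[OF ideal.axioms(1)[OF K]]
        additive_subgroup.a_inv_closed[OF ideal.axioms(1)[OF K]]
      by (intro M.submoduleI) (auto simp: M_def)
    moreover have "r \<in> carrier M" using r by (auto simp: M_def annihilator_def)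
    ultimately obtain g where g: "g \<in> mod_hom R M E" and gK: "\<And>y. y \<in> K \<Longrightarrow> g y = \<zero>\<^bsub>E\<^esub>"
      and gr: "g r = u"
      using cogenerator[OF M inj_Inl] rK by blast
    have g_mult: "g s = s \<odot>\<^bsub>E\<^esub> g \<one>" if "s \<in> carrier R" for s
      using mod_homD(3)[OF g, of s \<one>] that by (simp add: M_def)
    have "a \<odot>\<^bsub>E\<^esub> g \<one> = \<zero>\<^bsub>E\<^esub>" if "a \<in> K" for a
      using gK[OF that] g_mult[OF ideal.Icarr[OF K that]] by simp
    moreover have "g \<one> \<in> carrier E"
      using mod_homD(1)[OF g, of \<one>] by (simp add: M_def)
    ultimately have "g \<one> \<in> module_colon E {\<zero>\<^bsub>E\<^esub>} K"
      by (simp add: module_colon_def)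
    then have "r \<odot>\<^bsub>E\<^esub> g \<one> = \<zero>\<^bsub>E\<^esub>" using r by (auto simp: annihilator_def)
    then show False using g_mult[of r] gr u_nonzero r by (auto simp: annihilator_def)
  qed
qed

end

text \<open>An embedding \<open>\<iota>\<close> of \<open>k\<close> has image \<open>R u\<close> for \<open>u = \<iota> 1\<close>. If \<open>N\<close> contains a nonzero \<open>s u\<close>, then \<open>s\<close> is
  a unit and so \<open>u \<in> N\<close>.\<close>
lemma residue_hull_of_injective_hull:
  fixes R :: "('r, 'm) ring_scheme" and E :: "('r, 'e, 'n) module_scheme"
  assumes local: "local_ring R \<mm>" and noeth: "noetherian_ring R"
    and complete: "adically_complete R \<mm>"
    and hull: "injective_hull R (quot_module R \<mm>) E"
  shows "\<exists>u. residue_hull R E \<mm> u"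
proof -
  let ?k = "quot_module R \<mm>"
  have injective: "injective_module R E" and k: "module R ?k"
    using hull by (auto simp: injective_hull_def)
  then have E: "module R E" by (simp add: injective_module_def)
  interpret E: module R E by (rule E)
  have max: "maximalideal \<mm> R" using local by (simp add: local_ring_def)
  interpret \<mm>: ideal \<mm> R using max by (rule maximalideal.axioms(1))
  obtain \<iota> where \<iota>: "\<iota> \<in> mod_hom R ?k E" "inj_on \<iota> (carrier ?k)"
    and essential: "\<And>N. submodule N R E \<Longrightarrow> N \<noteq> {\<zero>\<^bsub>E\<^esub>} \<Longrightarrow> N \<inter> \<iota> ` carrier ?k \<noteq> {\<zero>\<^bsub>E\<^esub>}"
    using hull unfolding injective_hull_def by blast
  have carrier_k: "carrier ?k = {\<mm> +>\<^bsub>R\<^esub> r | r. r \<in> carrier R}"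
    by (auto simp: quot_module_def ring.defs FactRing_def A_RCOSETS_def')
  have zero_k: "\<zero>\<^bsub>?k\<^esub> = \<mm>"
    by (simp add: quot_module_def ring.defs FactRing_def)
  have zero_closed: "\<mm> \<in> carrier ?k"
    using abelian_monoid.zero_closed[OF abelian_group.axioms(1)[OF module.axioms(2)[OF k]]]
    by (simp add: zero_k)
  have smult_k: "r \<odot>\<^bsub>?k\<^esub> (\<mm> +>\<^bsub>R\<^esub> s) = \<mm> +>\<^bsub>R\<^esub> (r \<otimes>\<^bsub>R\<^esub> s)"
    if "r \<in> carrier R" "s \<in> carrier R" for r s
    using that by (simp add: quot_module_def ring.defs FactRing_def \<mm>.rcoset_mult_add)
  define u where "u = \<iota> (\<mm> +>\<^bsub>R\<^esub> \<one>\<^bsub>R\<^esub>)"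
  have one_k: "\<mm> +>\<^bsub>R\<^esub> \<one>\<^bsub>R\<^esub> \<in> carrier ?k" using carrier_k by auto
  have smult_u: "r \<odot>\<^bsub>E\<^esub> u = \<iota> (\<mm> +>\<^bsub>R\<^esub> r)" if "r \<in> carrier R" for r
    using mod_homD(3)[OF \<iota>(1) that one_k] smult_k that by (simp add: u_def)
  have \<iota>_zero: "\<iota> \<mm> = \<zero>\<^bsub>E\<^esub>"
    using mod_hom_zero[OF k E \<iota>(1)] by (simp add: zero_k)
  have u_closed: "u \<in> carrier E" using mod_homD(1)[OF \<iota>(1) one_k] by (simp add: u_def)
  have kill: "a \<odot>\<^bsub>E\<^esub> u = \<zero>\<^bsub>E\<^esub>" if a: "a \<in> \<mm>" for a
    using smult_u[OF \<mm>.Icarr[OF a]] \<mm>.a_rcos_const[OF a] \<iota>_zero by simp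
  have one_notin: "\<one>\<^bsub>R\<^esub> \<notin> \<mm>"
    using \<mm>.one_imp_carrier maximalideal.I_notcarr[OF max] by blast
  have u_nonzero: "u \<noteq> \<zero>\<^bsub>E\<^esub>"
  proof
    assume "u = \<zero>\<^bsub>E\<^esub>"
    then have "\<iota> (\<mm> +>\<^bsub>R\<^esub> \<one>\<^bsub>R\<^esub>) = \<iota> \<mm>" by (simp add: u_def \<iota>_zero)
    then have "\<mm> +>\<^bsub>R\<^esub> \<one>\<^bsub>R\<^esub> = \<mm>" using \<iota>(2) one_k zero_closed by (auto dest: inj_onD)
    then show False using one_notin \<mm>.rcos_const_imp_mem by auto
  qed
  have u_essential: "u \<in> N" if N: "submodule N R E" "N \<noteq> {\<zero>\<^bsub>E\<^esub>}" for N
  proof -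
    have "\<zero>\<^bsub>E\<^esub> \<in> N \<inter> \<iota> ` carrier ?k"
      using E.submodule_zero[OF N(1)] \<iota>_zero zero_closed by force
    then obtain z where z: "z \<in> N" "z \<in> \<iota> ` carrier ?k" "z \<noteq> \<zero>\<^bsub>E\<^esub>"
      using essential[OF N] by blast
    then obtain s where s: "s \<in> carrier R" "z = s \<odot>\<^bsub>E\<^esub> u"
      using carrier_k smult_u by auto
    then have "s \<notin> \<mm>" using z(3) kill by auto
    then obtain t where t: "t \<in> carrier R" "t \<otimes>\<^bsub>R\<^esub> s = \<one>\<^bsub>R\<^esub>"
      using noetherian_ring.unit_of_notin_max[OF noeth local] s by blast
    have "t \<odot>\<^bsub>E\<^esub> z = u"
      using s t u_closed by (simp flip: E.smult_assoc1)
    then show "u \<in> N" using E.submoduleE(4)[OF N(1) t(1) z(1)] by simp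
  qed
  have "residue_hull R E \<mm> u"
    by (intro residue_hull.intro residue_hull_axioms.intro)
      (use E noeth local complete injective u_closed u_nonzero kill u_essential in auto)
  then show ?thesis by blast
qed

section \<open>Endomorphisms of the hull and the annihilator correspondence\<close>

context residue_hull
begin

definition max_pow :: "nat \<Rightarrow> 'r set" where
  "max_pow n = \<mm> [^]\<^bsub>ideals_set R\<^esub> n"

abbreviation layer :: "nat \<Rightarrow> 'e set" where
  "layer n \<equiv> module_colon E {\<zero>\<^bsub>E\<^esub>} (max_pow n)"

lemma max_pow_0 [simp]: "max_pow 0 = carrier R"
  by (simp add: max_pow_def, simp add: ideals_set_def)

lemma max_pow_Suc: "max_pow (Suc n) = max_pow n \<cdot> \<mm>"
  by (simp add: max_pow_def, simp add: ideals_set_def)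

lemma max_pow_ideal: "ideal (max_pow n) R"
  by (induction n) (auto simp: max_pow_Suc R.oneideal intro: R.ideal_prod_is_ideal max_ideal)

lemma max_pow_carrier: "a \<in> max_pow n \<Longrightarrow> a \<in> carrier R"
  using ideal.Icarr[OF max_pow_ideal] .

lemma layer_submodule: "submodule (layer n) R E"
  using submodule_colon[OF zero_submodule] max_pow_carrier by blast

lemma layer_carrier: "z \<in> layer n \<Longrightarrow> z \<in> carrier E"
  by (simp add: module_colon_def)

lemma layer_0: "layer 0 = {\<zero>\<^bsub>E\<^esub>}"
proof
  show "layer 0 \<subseteq> {\<zero>\<^bsub>E\<^esub>}" using smult_one by (auto simp: module_colon_def dest!: bspec[of _ _ \<one>])
qed (auto simp: module_colon_def)

text \<open>This replaces computations with powers of \<open>\<mm>\<close> by induction on layers.\<close>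
lemma layer_Suc_iff:
  assumes y: "y \<in> carrier E"
  shows "y \<in> layer (Suc n) \<longleftrightarrow> (\<forall>a\<in>\<mm>. a \<odot>\<^bsub>E\<^esub> y \<in> layer n)"
proof safe
  fix a assume a: "a \<in> \<mm>" and "y \<in> layer (Suc n)"
  then have "(c \<otimes> a) \<odot>\<^bsub>E\<^esub> y = \<zero>\<^bsub>E\<^esub>" if "c \<in> max_pow n" for c
    using that ideal_prod.prod[of c "max_pow n" a \<mm> R]
    by (auto simp: module_colon_def max_pow_Suc)
  then show "a \<odot>\<^bsub>E\<^esub> y \<in> layer n"
    using y a max_carrier max_pow_carrier by (auto simp: module_colon_def smult_assoc1)
next
  assume kill: "\<forall>a\<in>\<mm>. a \<odot>\<^bsub>E\<^esub> y \<in> layer n"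
  have "b \<odot>\<^bsub>E\<^esub> y = \<zero>\<^bsub>E\<^esub>" if "b \<in> max_pow n \<cdot> \<mm>" for b
    using that
  proof induction
    case (prod c a)
    then show ?case
      using y kill max_carrier max_pow_carrier by (auto simp: module_colon_def smult_assoc1)
  next
    case (sum b b')
    then have "b \<in> carrier R" "b' \<in> carrier R"
      using R.ideal_prod_in_carrier[OF max_pow_ideal max_ideal] by blast+
    with sum show ?case using y by (simp add: smult_l_distr)
  qed
  then show "y \<in> layer (Suc n)" using y by (simp add: module_colon_def max_pow_Suc)
qed

lemma layer_mono: "n \<le> k \<Longrightarrow> layer n \<subseteq> layer k"
proof (induction rule: dec_induct)
  case (step k)
  have "layer k \<subseteq> layer (Suc k)"
    using layer_Suc_iff layer_carrier submoduleE(4)[OF layer_submodule] max_carrier by blast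
  with step show ?case by blast
qed simp

text \<open>Let \<open>T\<close> be the union of the layers. If \<open>T \<noteq> E\<close>, pick \<open>y \<notin> T\<close> with maximal annihilator. For
  \<open>a \<in> \<mm>\<close> the annihilator of \<open>a y\<close> is strictly larger, since it contains any \<open>s\<close> with \<open>s y = u\<close>;
  hence \<open>a y \<in> T\<close>. The ideals \<open>{b. b y \<in> layer n}\<close> form a chain that becomes stationary, so one
  layer contains all of \<open>\<mm> y\<close>, and the next one contains \<open>y\<close>.\<close>
lemma in_some_layer:
  assumes "x \<in> carrier E"
  shows "\<exists>n. x \<in> layer n"
proof (rule ccontr)
  assume x: "\<nexists>n. x \<in> layer n"
  define T where "T = (\<Union>n. layer n)"
  define \<F> where "\<F> = {annihilator R E {y} | y. y \<in> carrier E - T}"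
  have "\<exists>L\<in>\<F>. \<forall>L'\<in>\<F>. L \<subseteq> L' \<longrightarrow> L' = L"
    by (rule maximal_in_family) (use x assms ideal_annihilator in \<open>auto simp: \<F>_def T_def\<close>)
  then obtain y where y: "y \<in> carrier E" "y \<notin> T"
    and y_max: "\<And>y'. y' \<in> carrier E - T \<Longrightarrow> annihilator R E {y} \<subseteq> annihilator R E {y'}
      \<Longrightarrow> annihilator R E {y'} = annihilator R E {y}"
    by (auto simp: \<F>_def)
  have "y \<noteq> \<zero>\<^bsub>E\<^esub>" using y(2) submodule_zero[OF layer_submodule] by (auto simp: T_def)
  then obtain s where s: "s \<in> carrier R" "s \<odot>\<^bsub>E\<^esub> y = u" using u_multiple y(1) by blast
  have ann_y: "s \<notin> annihilator R E {y}" using s u_nonzero by (simp add: annihilator_def)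
  have max_T: "a \<odot>\<^bsub>E\<^esub> y \<in> T" if a: "a \<in> \<mm>" for a
  proof (rule ccontr)
    have ac: "a \<in> carrier R" using a max_carrier by blast
    have comm: "r \<odot>\<^bsub>E\<^esub> (a \<odot>\<^bsub>E\<^esub> y) = a \<odot>\<^bsub>E\<^esub> (r \<odot>\<^bsub>E\<^esub> y)" if "r \<in> carrier R" for r
      using that ac y(1) by (simp add: R.m_comm flip: smult_assoc1)
    assume "a \<odot>\<^bsub>E\<^esub> y \<notin> T"
    moreover have "annihilator R E {y} \<subseteq> annihilator R E {a \<odot>\<^bsub>E\<^esub> y}"
      using ac by (auto simp: annihilator_def comm)
    ultimately have "annihilator R E {a \<odot>\<^bsub>E\<^esub> y} = annihilator R E {y}"
      using y_max[of "a \<odot>\<^bsub>E\<^esub> y"] ac y(1) by simp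
    moreover have "s \<in> annihilator R E {a \<odot>\<^bsub>E\<^esub> y}"
      using s comm max_u[OF a] by (simp add: annihilator_def)
    ultimately show False using ann_y by simp
  qed
  define L where "L n = {b \<in> carrier R. b \<odot>\<^bsub>E\<^esub> y \<in> layer n}" for n
  have "ideal (L n) R" for n
  proof (rule idealI)
    show "ring R" by (rule R.ring_axioms)
    note closed = submoduleE(3-5)[OF layer_submodule] submodule_zero[OF layer_submodule]
    show "subgroup (L n) (add_monoid R)"
      using y(1) closed by (intro R.add.subgroupI)
        (auto simp: L_def smult_l_distr smult_l_minus simp flip: a_inv_def intro: exI[of _ \<zero>])
    fix a r assume "a \<in> L n" "r \<in> carrier R"
    then show "r \<otimes> a \<in> L n" "a \<otimes> r \<in> L n"
      using y(1) closed by (auto simp: L_def smult_assoc1 R.m_comm[of a r])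
  qed
  moreover have "L n \<subseteq> L k" if "n \<le> k" for n k
    using layer_mono[OF that] by (auto simp: L_def)
  then have "L n \<subseteq> L k \<or> L k \<subseteq> L n" for n k
    using nat_le_linear by blast
  ultimately have "subset.chain {I. ideal I R} (range L)"
    by (auto simp: pred_on.chain_def)
  then have "\<Union>(range L) \<in> range L" by (rule ideal_chain_is_trivial[rotated]) simp
  then obtain n where n: "\<Union>(range L) = L n" by auto
  have "a \<in> L n" if "a \<in> \<mm>" for a
    unfolding n[symmetric] using max_T[OF that] max_carrier[OF that] by (auto simp: L_def T_def)
  then have "y \<in> layer (Suc n)" using y(1) by (simp add: layer_Suc_iff L_def)
  with y(2) show False by (auto simp: T_def)
qed

lemma mod_hom_minus_smult:
  assumes "h \<in> mod_hom R E E" "d \<in> carrier R"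
  shows "(\<lambda>z. h z \<ominus>\<^bsub>E\<^esub> d \<odot>\<^bsub>E\<^esub> z) \<in> mod_hom R E E"
  unfolding mod_hom_def
proof (intro CollectI conjI ballI)
  note h = mod_homD[OF assms(1)]
  show "(\<lambda>z. h z \<ominus>\<^bsub>E\<^esub> d \<odot>\<^bsub>E\<^esub> z) \<in> carrier E \<rightarrow> carrier E"
    using h(1) assms(2) by auto
  fix x assume x: "x \<in> carrier E"
  show "h (x \<oplus>\<^bsub>E\<^esub> y) \<ominus>\<^bsub>E\<^esub> d \<odot>\<^bsub>E\<^esub> (x \<oplus>\<^bsub>E\<^esub> y) = (h x \<ominus>\<^bsub>E\<^esub> d \<odot>\<^bsub>E\<^esub> x) \<oplus>\<^bsub>E\<^esub> (h y \<ominus>\<^bsub>E\<^esub> d \<odot>\<^bsub>E\<^esub> y)"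
    if "y \<in> carrier E" for y
    using x that h assms(2) by (simp add: M.minus_eq smult_r_distr M.minus_add M.a_ac)
  show "h (r \<odot>\<^bsub>E\<^esub> x) \<ominus>\<^bsub>E\<^esub> d \<odot>\<^bsub>E\<^esub> (r \<odot>\<^bsub>E\<^esub> x) = r \<odot>\<^bsub>E\<^esub> (h x \<ominus>\<^bsub>E\<^esub> d \<odot>\<^bsub>E\<^esub> x)"
    if "r \<in> carrier R" for r
  proof -
    have "d \<odot>\<^bsub>E\<^esub> (r \<odot>\<^bsub>E\<^esub> x) = r \<odot>\<^bsub>E\<^esub> (d \<odot>\<^bsub>E\<^esub> x)"
      using x that assms(2) by (simp add: R.m_comm flip: smult_assoc1)
    then show ?thesis
      using x that h assms(2) by (simp add: M.minus_eq smult_r_distr smult_r_minus)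
  qed
qed

text \<open>If every element of \<open>S\<close> maps \<open>N\<close> into the socle and the common kernel of these maps is killed by
  \<open>h\<close>, then \<open>h\<close> is a linear combination of them on \<open>N\<close>, as for functionals on a vector space. By
  induction on \<open>S\<close>: on the common kernel \<open>N'\<close> of the maps other than \<open>a\<close>, the homomorphism \<open>h\<close> is a
  multiple of \<open>a\<close> because the socle is one-dimensional. Subtracting that multiple from \<open>h\<close> makes \<open>N'\<close>
  part of the kernel.\<close>
lemma hom_eq_smult_of_socle_valued:
  assumes "finite S" "S \<subseteq> carrier R" and N: "submodule N R E"
    and socle_valued: "\<And>z a b. z \<in> N \<Longrightarrow> a \<in> S \<Longrightarrow> b \<in> \<mm> \<Longrightarrow> b \<odot>\<^bsub>E\<^esub> (a \<odot>\<^bsub>E\<^esub> z) = \<zero>\<^bsub>E\<^esub>"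
    and "h \<in> mod_hom R E E"
    and "\<And>z. z \<in> N \<Longrightarrow> (\<And>a. a \<in> S \<Longrightarrow> a \<odot>\<^bsub>E\<^esub> z = \<zero>\<^bsub>E\<^esub>) \<Longrightarrow> h z = \<zero>\<^bsub>E\<^esub>"
  shows "\<exists>r\<in>carrier R. \<forall>z\<in>N. h z = r \<odot>\<^bsub>E\<^esub> z"
  using assms(1,2,4-)
proof (induction S arbitrary: h rule: finite_induct)
  case empty
  then show ?case using submoduleE(1)[OF N] by (intro bexI[of _ \<zero>]) auto
next
  case (insert a S)
  note hom = mod_homD[OF insert.prems(3)]
  have a: "a \<in> carrier R" and S: "S \<subseteq> carrier R" using insert.prems(1) by auto
  define N' where "N' = N \<inter> module_colon E {\<zero>\<^bsub>E\<^esub>} S"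
  have N'_carrier: "z \<in> carrier E" if "z \<in> N'" for z
    using that by (auto simp: N'_def module_colon_def)
  have N'_smult: "r \<odot>\<^bsub>E\<^esub> z \<in> N'" if "r \<in> carrier R" "z \<in> N'" for r z
    using that submoduleE(4)[OF N] submoduleE(4)[OF submodule_colon[OF zero_submodule S]]
    by (auto simp: N'_def)
  have N'_minus: "z \<ominus>\<^bsub>E\<^esub> z' \<in> N'" if "z \<in> N'" "z' \<in> N'" for z z'
    using that submodule_minus[OF N] submodule_minus[OF submodule_colon[OF zero_submodule S]]
    by (auto simp: N'_def)
  have kill: "h z = \<zero>\<^bsub>E\<^esub>" if "z \<in> N'" "a \<odot>\<^bsub>E\<^esub> z = \<zero>\<^bsub>E\<^esub>" for z
    using insert.prems(4)[of z] that by (auto simp: N'_def module_colon_def)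
  have "\<exists>c\<in>carrier R. \<forall>z\<in>N'. h z = (c \<otimes> a) \<odot>\<^bsub>E\<^esub> z"
  proof (cases "\<forall>z\<in>N'. a \<odot>\<^bsub>E\<^esub> z = \<zero>\<^bsub>E\<^esub>")
    case True
    then show ?thesis using kill a N'_carrier by (intro bexI[of _ \<zero>]) auto
  next
    case False
    then obtain z1 where z1: "z1 \<in> N'" "a \<odot>\<^bsub>E\<^esub> z1 \<noteq> \<zero>\<^bsub>E\<^esub>" by blast
    then obtain s where s: "s \<in> carrier R" "s \<odot>\<^bsub>E\<^esub> (a \<odot>\<^bsub>E\<^esub> z1) = u"
      using u_multiple[of "a \<odot>\<^bsub>E\<^esub> z1"] a N'_carrier by auto
    \<comment> \<open>z0 is normalized so that a maps it to u; then h z0 determines the factor c.\<close>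
    define z0 where "z0 = s \<odot>\<^bsub>E\<^esub> z1"
    have z0: "z0 \<in> N'" "z0 \<in> carrier E" using z1 s N'_smult N'_carrier by (auto simp: z0_def)
    have az0: "a \<odot>\<^bsub>E\<^esub> z0 = u"
      using s z1 a N'_carrier by (simp add: z0_def R.m_comm flip: smult_assoc1)
    have "b \<odot>\<^bsub>E\<^esub> h z0 = \<zero>\<^bsub>E\<^esub>" if "b \<in> \<mm>" for b
    proof -
      have b: "b \<in> carrier R" using that max_carrier by blast
      have "a \<odot>\<^bsub>E\<^esub> (b \<odot>\<^bsub>E\<^esub> z0) = b \<odot>\<^bsub>E\<^esub> u"
        using a b z0 by (simp add: R.m_comm az0[symmetric] flip: smult_assoc1)
      then have "h (b \<odot>\<^bsub>E\<^esub> z0) = \<zero>\<^bsub>E\<^esub>" using kill N'_smult b z0 max_u[OF that] by simp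
      then show ?thesis using hom(3) b z0 by simp
    qed
    then obtain c where c: "c \<in> carrier R" "h z0 = c \<odot>\<^bsub>E\<^esub> u"
      using socle hom(1) z0 by blast
    have "h z = (c \<otimes> a) \<odot>\<^bsub>E\<^esub> z" if z: "z \<in> N'" for z
    proof -
      have zE: "z \<in> carrier E" using z by (rule N'_carrier)
      have "\<And>b. b \<in> \<mm> \<Longrightarrow> b \<odot>\<^bsub>E\<^esub> (a \<odot>\<^bsub>E\<^esub> z) = \<zero>\<^bsub>E\<^esub>"
        using insert.prems(2) z by (simp add: N'_def)
      then obtain t where t: "t \<in> carrier R" "a \<odot>\<^bsub>E\<^esub> z = t \<odot>\<^bsub>E\<^esub> u"
        using socle[of "a \<odot>\<^bsub>E\<^esub> z"] a zE by auto
      have tz0: "a \<odot>\<^bsub>E\<^esub> (t \<odot>\<^bsub>E\<^esub> z0) = t \<odot>\<^bsub>E\<^esub> u"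
        using a t z0 by (simp add: R.m_comm az0[symmetric] flip: smult_assoc1)
      have "a \<odot>\<^bsub>E\<^esub> (z \<ominus>\<^bsub>E\<^esub> t \<odot>\<^bsub>E\<^esub> z0) = \<zero>\<^bsub>E\<^esub>"
        using a zE t z0 tz0 by (simp add: M.minus_eq smult_r_distr smult_r_minus M.r_neg)
      then have "h (z \<ominus>\<^bsub>E\<^esub> t \<odot>\<^bsub>E\<^esub> z0) = \<zero>\<^bsub>E\<^esub>"
        using kill N'_minus z N'_smult t z0 by simp
      moreover have "h z = h ((z \<ominus>\<^bsub>E\<^esub> t \<odot>\<^bsub>E\<^esub> z0) \<oplus>\<^bsub>E\<^esub> t \<odot>\<^bsub>E\<^esub> z0)"
        using zE t z0 by (simp add: M.minus_eq M.a_assoc M.l_neg)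
      ultimately have "h z = t \<odot>\<^bsub>E\<^esub> h z0"
        using hom zE t z0 by simp
      also have "\<dots> = c \<odot>\<^bsub>E\<^esub> (a \<odot>\<^bsub>E\<^esub> z)"
        using c t by (simp add: R.m_comm flip: smult_assoc1)
      finally show ?thesis using a c zE by (simp add: smult_assoc1)
    qed
    with c show ?thesis by blast
  qed
  then obtain c where c: "c \<in> carrier R" "\<And>z. z \<in> N' \<Longrightarrow> h z = (c \<otimes> a) \<odot>\<^bsub>E\<^esub> z" by blast
  have ca: "c \<otimes> a \<in> carrier R" using c a by simp
  have "\<exists>r\<in>carrier R. \<forall>z\<in>N. h z \<ominus>\<^bsub>E\<^esub> (c \<otimes> a) \<odot>\<^bsub>E\<^esub> z = r \<odot>\<^bsub>E\<^esub> z"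
  proof (rule insert.IH)
    show "(\<lambda>z. h z \<ominus>\<^bsub>E\<^esub> (c \<otimes> a) \<odot>\<^bsub>E\<^esub> z) \<in> mod_hom R E E"
      using insert.prems(3) ca by (rule mod_hom_minus_smult)
    fix z assume "z \<in> N" "\<And>a. a \<in> S \<Longrightarrow> a \<odot>\<^bsub>E\<^esub> z = \<zero>\<^bsub>E\<^esub>"
    then have "z \<in> N'" using submoduleE(1)[OF N] by (auto simp: N'_def module_colon_def)
    then show "h z \<ominus>\<^bsub>E\<^esub> (c \<otimes> a) \<odot>\<^bsub>E\<^esub> z = \<zero>\<^bsub>E\<^esub>"
      using c ca hom(1) N'_carrier by (simp add: minus_eq_zero_iff)
  qed (use S insert.prems(2) in auto)
  then obtain r where r: "r \<in> carrier R" "\<And>z. z \<in> N \<Longrightarrow> h z \<ominus>\<^bsub>E\<^esub> (c \<otimes> a) \<odot>\<^bsub>E\<^esub> z = r \<odot>\<^bsub>E\<^esub> z"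
    by blast
  have "h z = (r \<oplus> c \<otimes> a) \<odot>\<^bsub>E\<^esub> z" if "z \<in> N" for z
  proof -
    have z: "z \<in> carrier E" using that submoduleE(1)[OF N] by blast
    have "h z = (h z \<ominus>\<^bsub>E\<^esub> (c \<otimes> a) \<odot>\<^bsub>E\<^esub> z) \<oplus>\<^bsub>E\<^esub> (c \<otimes> a) \<odot>\<^bsub>E\<^esub> z"
      using z hom(1) ca by (simp add: M.minus_eq M.a_assoc M.l_neg)
    then show ?thesis using r that z ca by (simp add: smult_l_distr)
  qed
  with r ca show ?case by blast
qed

text \<open>A multiplier \<open>r\<close> that is correct on layer \<open>n\<close> is corrected on layer \<open>n + 1\<close>: the difference
  \<open>h - r\<close> kills layer \<open>n\<close>, which is the common kernel of a finite set of generators of \<open>\<mm>\<^sup>n\<close>, and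
  these map layer \<open>n + 1\<close> into the socle.\<close>
lemma hom_eq_smult_on_layer:
  assumes "h \<in> mod_hom R E E"
  shows "\<exists>r\<in>carrier R. \<forall>z\<in>layer n. h z = r \<odot>\<^bsub>E\<^esub> z"
proof (induction n)
  case 0
  show ?case
    unfolding layer_0 using mod_hom_zero[OF module_axioms module_axioms assms]
    by (intro bexI[of _ \<zero>]) auto
next
  case (Suc n)
  then obtain r where r: "r \<in> carrier R" "\<And>z. z \<in> layer n \<Longrightarrow> h z = r \<odot>\<^bsub>E\<^esub> z" by blast
  obtain S where S: "S \<subseteq> carrier R" "finite S" "max_pow n = Idl S"
    using finetely_gen[OF max_pow_ideal] by blast
  have "\<exists>r'\<in>carrier R. \<forall>z\<in>layer (Suc n). h z \<ominus>\<^bsub>E\<^esub> r \<odot>\<^bsub>E\<^esub> z = r' \<odot>\<^bsub>E\<^esub> z"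
  proof (rule hom_eq_smult_of_socle_valued[OF S(2,1) layer_submodule])
    fix z a b assume z: "z \<in> layer (Suc n)" and "a \<in> S" and b: "b \<in> \<mm>"
    then have a: "a \<in> max_pow n" using S R.genideal_self by blast
    have "b \<odot>\<^bsub>E\<^esub> (a \<odot>\<^bsub>E\<^esub> z) = a \<odot>\<^bsub>E\<^esub> (b \<odot>\<^bsub>E\<^esub> z)"
      using max_pow_carrier[OF a] max_carrier[OF b] layer_carrier[OF z]
      by (simp add: R.m_comm flip: smult_assoc1)
    moreover have "b \<odot>\<^bsub>E\<^esub> z \<in> layer n" using z b layer_Suc_iff layer_carrier by blast
    ultimately show "b \<odot>\<^bsub>E\<^esub> (a \<odot>\<^bsub>E\<^esub> z) = \<zero>\<^bsub>E\<^esub>" using a by (simp add: module_colon_def)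
  next
    show "(\<lambda>z. h z \<ominus>\<^bsub>E\<^esub> r \<odot>\<^bsub>E\<^esub> z) \<in> mod_hom R E E"
      using assms r(1) by (rule mod_hom_minus_smult)
  next
    fix z assume z: "z \<in> layer (Suc n)" and kill: "\<And>a. a \<in> S \<Longrightarrow> a \<odot>\<^bsub>E\<^esub> z = \<zero>\<^bsub>E\<^esub>"
    have "max_pow n \<subseteq> annihilator R E {z}"
      unfolding S(3) using kill S(1) layer_carrier[OF z]
      by (intro R.genideal_minimal ideal_annihilator) (auto simp: annihilator_def)
    then have "z \<in> layer n" using layer_carrier[OF z] by (auto simp: module_colon_def annihilator_def)
    then show "h z \<ominus>\<^bsub>E\<^esub> r \<odot>\<^bsub>E\<^esub> z = \<zero>\<^bsub>E\<^esub>"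
      using r layer_carrier[OF z] by (simp add: minus_eq_zero_iff)
  qed
  then obtain r' where r': "r' \<in> carrier R"
    "\<And>z. z \<in> layer (Suc n) \<Longrightarrow> h z \<ominus>\<^bsub>E\<^esub> r \<odot>\<^bsub>E\<^esub> z = r' \<odot>\<^bsub>E\<^esub> z" by blast
  have "h z = (r' \<oplus> r) \<odot>\<^bsub>E\<^esub> z" if "z \<in> layer (Suc n)" for z
  proof -
    have z: "z \<in> carrier E" using that by (rule layer_carrier)
    have "h z = (h z \<ominus>\<^bsub>E\<^esub> r \<odot>\<^bsub>E\<^esub> z) \<oplus>\<^bsub>E\<^esub> r \<odot>\<^bsub>E\<^esub> z"
      using z mod_homD(1)[OF assms] r by (simp add: M.minus_eq M.a_assoc M.l_neg)
    then show ?thesis using r r' that z by (simp add: smult_l_distr)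
  qed
  with r r' show ?case by blast
qed

text \<open>Multipliers that agree on layer \<open>n\<close> differ by an element of \<open>(0 :\<^sub>R (0 :\<^sub>E \<mm>\<^sup>n)) = \<mm>\<^sup>n\<close>, so a
  sequence of multipliers for the layers is Cauchy in the \<open>\<mm>\<close>-adic topology.\<close>
lemma hom_eq_smult:
  assumes h: "h \<in> mod_hom R E E"
  shows "\<exists>r\<in>carrier R. \<forall>z\<in>carrier E. h z = r \<odot>\<^bsub>E\<^esub> z"
proof -
  obtain r where r: "\<And>n. r n \<in> carrier R" "\<And>n z. z \<in> layer n \<Longrightarrow> h z = r n \<odot>\<^bsub>E\<^esub> z"
    using hom_eq_smult_on_layer[OF h] by metis
  have diff: "r i \<ominus> r k \<in> max_pow n" if "n \<le> i" "n \<le> k" for i k n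
  proof -
    note le = that
    have "(r i \<ominus> r k) \<odot>\<^bsub>E\<^esub> z = \<zero>\<^bsub>E\<^esub>" if z: "z \<in> layer n" for z
    proof -
      have "r i \<odot>\<^bsub>E\<^esub> z = r k \<odot>\<^bsub>E\<^esub> z"
        using r(2)[of z i] r(2)[of z k] subsetD[OF layer_mono[OF le(1)] z]
          subsetD[OF layer_mono[OF le(2)] z] by simp
      then show ?thesis
        using r(1) layer_carrier[OF z] by (simp add: smult_minus_distr minus_eq_zero_iff)
    qed
    then have "r i \<ominus> r k \<in> annihilator R E (layer n)"
      using r(1) by (simp add: annihilator_def)
    then show ?thesis by (simp add: annihilator_colon max_pow_ideal)
  qed
  then have "\<forall>n::nat. \<exists>N::nat. \<forall>i\<ge>N. \<forall>k\<ge>N. r i \<ominus> r k \<in> max_pow n" by blast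
  then obtain y where y: "y \<in> carrier R" and
    lim: "\<And>n. \<exists>N::nat. \<forall>i\<ge>N. r i \<ominus> y \<in> max_pow n"
    using complete r(1) unfolding adically_complete_def max_pow_def by blast
  have "h z = y \<odot>\<^bsub>E\<^esub> z" if z: "z \<in> carrier E" for z
  proof -
    obtain n where n: "z \<in> layer n" using in_some_layer z by blast
    obtain N where N: "\<And>i. i \<ge> N \<Longrightarrow> r i \<ominus> y \<in> max_pow n" using lim by blast
    \<comment> \<open>Index i is late enough for both: r i is correct on layer n and close to y.\<close>
    define i where "i = n + N"
    have "(r i \<ominus> y) \<odot>\<^bsub>E\<^esub> z = \<zero>\<^bsub>E\<^esub>"
      using n N[of i] by (simp add: i_def module_colon_def)
    then have "r i \<odot>\<^bsub>E\<^esub> z = y \<odot>\<^bsub>E\<^esub> z"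
      using r(1) y z by (simp add: smult_minus_distr minus_eq_zero_iff)
    moreover have "z \<in> layer i" using n layer_mono[of n i] by (auto simp: i_def)
    ultimately show ?thesis using r(2) by simp
  qed
  with y show ?thesis by blast
qed

text \<open>For \<open>x \<notin> C\<close> the cogenerator property gives an endomorphism of \<open>E\<close> killing \<open>C\<close> but not \<open>x\<close>. It is
  multiplication by some \<open>r\<close>, so \<open>r\<close> annihilates \<open>C\<close> but not \<open>x\<close>.\<close>
lemma colon_annihilator:
  assumes C: "submodule C R E"
  shows "module_colon E {\<zero>\<^bsub>E\<^esub>} (annihilator R E C) = C"
proof
  show "C \<subseteq> module_colon E {\<zero>\<^bsub>E\<^esub>} (annihilator R E C)"
    using submoduleE(1)[OF C] by (auto simp: module_colon_def annihilator_def)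
  show "module_colon E {\<zero>\<^bsub>E\<^esub>} (annihilator R E C) \<subseteq> C"
  proof (rule subsetI, rule ccontr)
    fix x assume x: "x \<in> module_colon E {\<zero>\<^bsub>E\<^esub>} (annihilator R E C)" and xC: "x \<notin> C"
    then have xE: "x \<in> carrier E" by (simp add: module_colon_def)
    obtain g where g: "g \<in> mod_hom R E E" "\<And>y. y \<in> C \<Longrightarrow> g y = \<zero>\<^bsub>E\<^esub>" "g x = u"
      using cogenerator[OF module_axioms inj_Inr C xE xC] by blast
    obtain r where r: "r \<in> carrier R" "\<And>z. z \<in> carrier E \<Longrightarrow> g z = r \<odot>\<^bsub>E\<^esub> z"
      using hom_eq_smult[OF g(1)] by blast
    have "r \<in> annihilator R E C"
      using r g(2) submoduleE(1)[OF C] by (force simp: annihilator_def)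
    then have "r \<odot>\<^bsub>E\<^esub> x = \<zero>\<^bsub>E\<^esub>" using x by (simp add: module_colon_def)
    then show False using r g(3) xE u_nonzero by simp
  qed
qed

end

section \<open>Tight closure in a domain of positive characteristic\<close>

context cring
begin

lemma binomial_theorem:
  assumes x: "x \<in> carrier R" and y: "y \<in> carrier R"
  shows "(x \<oplus> y) [^] n = (\<Oplus>i\<in>{..n}. add_pow R (n choose i) (x [^] i \<otimes> y [^] (n - i)))"
proof (induction n)
  case 0
  show ?case using x y by simp
next
  case (Suc n)
  \<comment> \<open>Multiplying the sum for n by x gives the terms t (n choose i) i, multiplying it by y gives
    t (n choose Suc i) i and one further power of y, so Pascal's rule applies term by term.\<close>
  let ?t = "\<lambda>k i. add_pow R k (x [^] Suc i \<otimes> y [^] (n - i))"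
  let ?b = "\<lambda>i. add_pow R (n choose i) (x [^] i \<otimes> y [^] (n - i))"
  let ?b' = "\<lambda>i. add_pow R (n choose i) (x [^] i \<otimes> y [^] (Suc n - i))"
  note c = x y
  have X: "x \<otimes> (\<Oplus>i\<in>{..n}. ?b i) = (\<Oplus>i\<in>{..n}. ?t (n choose i) i)"
  proof -
    have "x \<otimes> (\<Oplus>i\<in>{..n}. ?b i) = (\<Oplus>i\<in>{..n}. x \<otimes> ?b i)"
      using c by (intro finsum_rdistr) auto
    also have "\<dots> = (\<Oplus>i\<in>{..n}. ?t (n choose i) i)"
      using c by (intro finsum_cong') (auto simp: add_pow_rdistr m_ac)
    finally show ?thesis .
  qed
  have Y: "y \<otimes> (\<Oplus>i\<in>{..n}. ?b i) = (\<Oplus>i\<in>{..n}. ?t (n choose Suc i) i) \<oplus> y [^] Suc n"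
  proof -
    have "y \<otimes> (\<Oplus>i\<in>{..n}. ?b i) = (\<Oplus>i\<in>{..n}. y \<otimes> ?b i)"
      using c by (intro finsum_rdistr) auto
    also have "\<dots> = (\<Oplus>i\<in>{..n}. ?b' i)"
      using c by (intro finsum_cong') (auto simp: add_pow_rdistr m_ac Suc_diff_le)
    also have "\<dots> = (\<Oplus>i\<in>{..Suc n}. ?b' i)"
      using c by (subst finsum_Suc) (auto simp: binomial_eq_0)
    also have "\<dots> = (\<Oplus>i\<in>{..n}. ?b' (Suc i)) \<oplus> ?b' 0"
      using c by (subst finsum_Suc2) auto
    finally show ?thesis using c by simp
  qed
  have "(x \<oplus> y) [^] Suc n = x \<otimes> (\<Oplus>i\<in>{..n}. ?b i) \<oplus> y \<otimes> (\<Oplus>i\<in>{..n}. ?b i)"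
  proof -
    have "(\<Oplus>i\<in>{..n}. ?b i) \<in> carrier R" using c by (intro finsum_closed) auto
    then show ?thesis using c Suc.IH by (simp add: l_distr m_comm)
  qed
  also have "\<dots> = (\<Oplus>i\<in>{..n}. ?t (n choose i) i) \<oplus> (\<Oplus>i\<in>{..n}. ?t (n choose Suc i) i) \<oplus> y [^] Suc n"
    unfolding X Y using c by (intro a_assoc[symmetric]) (auto intro!: finsum_closed simp del: nat_pow_Suc)
  also have "(\<Oplus>i\<in>{..n}. ?t (n choose i) i) \<oplus> (\<Oplus>i\<in>{..n}. ?t (n choose Suc i) i)
      = (\<Oplus>i\<in>{..n}. ?t (n choose i) i \<oplus> ?t (n choose Suc i) i)"
    using c by (intro finsum_addf[symmetric]) (auto simp del: nat_pow_Suc)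
  also have "\<dots> = (\<Oplus>i\<in>{..n}. ?t (Suc n choose Suc i) i)"
    using c by (intro finsum_cong') (auto simp del: nat_pow_Suc simp: add.nat_pow_mult)
  also have "\<dots> \<oplus> y [^] Suc n = (\<Oplus>i\<in>{..Suc n}. add_pow R (Suc n choose i) (x [^] i \<otimes> y [^] (Suc n - i)))"
    using c by (subst finsum_Suc2) (auto simp del: nat_pow_Suc binomial_Suc_Suc)
  finally show ?case .
qed

lemma char_multiple_eq_zero:
  fixes p k :: nat
  assumes "add_pow R p \<one> = \<zero>" "p dvd k" "x \<in> carrier R"
  shows "add_pow R k x = \<zero>"
proof -
  obtain l where k: "k = p * l" using assms(2) by blast
  have "add_pow R k \<one> = add_pow R l (add_pow R p \<one>)" by (simp add: k add.nat_pow_pow mult.commute)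
  then have "add_pow R k \<one> = \<zero>" by (simp add: assms(1))
  moreover have "add_pow R k x = (add_pow R k \<one>) \<otimes> x" using assms(3) by (simp add: add_pow_ldistr)
  ultimately show ?thesis using assms(3) by simp
qed

text \<open>The inner binomial coefficients of a prime exponent are divisible by it.\<close>
lemma frobenius_add:
  fixes p e :: nat
  assumes p: "prime p" and char: "add_pow R p \<one> = \<zero>"
    and x: "x \<in> carrier R" and y: "y \<in> carrier R"
  shows "(x \<oplus> y) [^] (p ^ e) = x [^] (p ^ e) \<oplus> y [^] (p ^ e)"
proof (induction e)
  case 0
  show ?case using x y by (simp add: nat_pow_eone)
next
  case (Suc e)
  have frob: "(a \<oplus> b) [^] p = a [^] p \<oplus> b [^] p" if a: "a \<in> carrier R" and b: "b \<in> carrier R" for a b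
  proof -
    let ?f = "\<lambda>i. add_pow R (p choose i) (a [^] i \<otimes> b [^] (p - i))"
    have p_pos: "0 < p" using p by (rule prime_gt_0_nat)
    have "(\<Oplus>i\<in>{..p}. ?f i) = (\<Oplus>i\<in>{0, p}. ?f i)"
    proof (rule add.finprod_mono_neutral_cong_right)
      show "?f i = \<zero>" if "i \<in> {..p} - {0, p}" for i
        using that a b p_pos
        by (intro char_multiple_eq_zero[OF char] dvd_choose_prime[OF _ _ _ p]) auto
    qed (use a b in auto)
    also have "\<dots> = b [^] p \<oplus> a [^] p"
      using a b p_pos by (subst finsum_insert) auto
    finally show ?thesis using a b by (simp add: binomial_theorem a_comm)
  qed
  have "(x \<oplus> y) [^] (p ^ Suc e) = ((x \<oplus> y) [^] (p ^ e)) [^] p"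
    using x y by (simp add: nat_pow_pow mult.commute)
  also have "\<dots> = (x [^] (p ^ e)) [^] p \<oplus> (y [^] (p ^ e)) [^] p"
    using x y by (simp add: Suc frob)
  finally show ?case using x y by (simp add: nat_pow_pow mult.commute)
qed

end

context "domain"
begin

lemma ring_char_eq_zero:
  assumes "ring_char R > 0"
  shows "add_pow R (ring_char R) \<one> = \<zero>"
proof -
  have ex: "\<exists>n. n > 0 \<and> add_pow R (n::nat) \<one> = \<zero>"
    using assms by (auto simp: ring_char_def split: if_splits)
  then show ?thesis using LeastI_ex[OF ex] by (auto simp: ring_char_def)
qed

lemma ring_char_le:
  assumes "n > 0" "add_pow R (n::nat) \<one> = \<zero>"
  shows "ring_char R \<le> n"
  using assms by (auto simp: ring_char_def intro: Least_le)

text \<open>A proper factorization \<open>p = a b\<close> would give zero divisors \<open>a 1\<close> and \<open>b 1\<close>, both nonzero by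
  minimality of \<open>p\<close>.\<close>
lemma ring_char_prime:
  assumes pos: "ring_char R > 0"
  shows "prime (ring_char R)"
  unfolding prime_nat_iff
proof safe
  let ?p = "ring_char R"
  have p: "add_pow R ?p \<one> = \<zero>" using ring_char_eq_zero[OF pos] .
  show "1 < ?p"
  proof (rule ccontr)
    assume "\<not> 1 < ?p"
    then have "?p = 1" using pos by simp
    then show False using p by simp
  qed
  fix a assume "a dvd ?p" and a: "a \<noteq> ?p"
  then obtain b where ab: "?p = a * b" by blast
  then have "0 < a" "0 < b" using pos by auto
  have "add_pow R a \<one> \<otimes> add_pow R b \<one> = add_pow R ?p \<one>"
    by (simp add: add_pow_ldistr ab add.nat_pow_pow mult.commute)
  then have "add_pow R a \<one> = \<zero> \<or> add_pow R b \<one> = \<zero>"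
    using p by (simp add: integral_iff)
  then have "?p \<le> a \<or> ?p \<le> b"
    using ring_char_le \<open>0 < a\<close> \<open>0 < b\<close> by blast
  then show "a = 1"
    using a ab \<open>0 < a\<close> \<open>0 < b\<close> by auto
qed

text \<open>The zero ideal of a domain is prime and contained in every prime.\<close>
lemma outside_minimal_primes_eq: "outside_minimal_primes R = carrier R - {\<zero>}"
proof -
  have "minimal_prime P R \<longleftrightarrow> P = {\<zero>}" for P
  proof
    assume P: "minimal_prime P R"
    then have "{\<zero>} \<subseteq> P"
      using additive_subgroup.zero_closed[OF ideal.axioms(1)[OF primeideal.axioms(1)]]
      by (auto simp: minimal_prime_def)
    then show "P = {\<zero>}" using P zeroprimeideal by (auto simp: minimal_prime_def)
  next
    assume P: "P = {\<zero>}"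
    have "\<zero> \<in> Q" if "primeideal Q R" for Q
      using additive_subgroup.zero_closed[OF ideal.axioms(1)[OF primeideal.axioms(1)[OF that]]] .
    then show "minimal_prime P R" using P zeroprimeideal by (auto simp: minimal_prime_def)
  qed
  then show ?thesis by (simp add: outside_minimal_primes_def)
qed

text \<open>Closure under sums uses that Frobenius powers are additive, and that the product of two
  multipliers is again nonzero.\<close>
lemma tight_closure_ideal:
  assumes char: "ring_char R > 0" and I: "ideal I R"
  shows "ideal (tight_closure R I) R"
proof (rule idealI)
  define q where "q e = ring_char R ^ e" for e
  have q_pos: "q e > 0" for e using char by (simp add: q_def)
  have tc: "z \<in> tight_closure R I \<longleftrightarrow> z \<in> carrier R \<and>
      (\<exists>c\<in>carrier R - {\<zero>}. \<exists>e0. \<forall>e\<ge>e0. c \<otimes> z [^] q e \<in> frobenius_power R I (q e))" for z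
    by (auto simp: tight_closure_def outside_minimal_primes_eq q_def)
  have F: "ideal (frobenius_power R I (q e)) R" for e
    unfolding frobenius_power_def using ideal.Icarr[OF I] by (intro genideal_ideal) auto
  have mult: "r \<otimes> z \<in> tight_closure R I" if r: "r \<in> carrier R" and z: "z \<in> tight_closure R I" for r z
  proof -
    obtain c e0 where c: "z \<in> carrier R" "c \<in> carrier R - {\<zero>}"
      "\<And>e. e \<ge> e0 \<Longrightarrow> c \<otimes> z [^] q e \<in> frobenius_power R I (q e)"
      using z tc by blast
    have "c \<otimes> (r \<otimes> z) [^] q e \<in> frobenius_power R I (q e)" if "e \<ge> e0" for e
    proof -
      have "c \<otimes> (r \<otimes> z) [^] q e = r [^] q e \<otimes> (c \<otimes> z [^] q e)"
        using r c by (simp add: nat_pow_distrib m_lcomm)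
      then show ?thesis using ideal.I_l_closed[OF F c(3)[OF that]] r by simp
    qed
    then show ?thesis using r c tc by blast
  qed
  show "ring R" by (rule ring_axioms)
  show "subgroup (tight_closure R I) (add_monoid R)"
  proof (rule add.subgroupI)
    show "tight_closure R I \<subseteq> carrier R" by (auto simp: tc)
    have "\<one> \<otimes> \<zero> [^] q e \<in> frobenius_power R I (q e)" for e
      using q_pos[of e] additive_subgroup.zero_closed[OF ideal.axioms(1)[OF F]]
      by (simp add: nat_pow_zero)
    then have "\<zero> \<in> tight_closure R I" 
      unfolding tc by (intro conjI bexI[of _ \<one>] exI[of _ "0::nat"]) simp_all
    then show "tight_closure R I \<noteq> {}" by blast
  next
    fix a assume a: "a \<in> tight_closure R I"
    then have "\<ominus> a = (\<ominus> \<one>) \<otimes> a" by (simp add: tc l_minus)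
    then show "\<ominus> a \<in> tight_closure R I"
      using mult[OF _ a, of "\<ominus> \<one>"] by simp
  next
    fix a b assume "a \<in> tight_closure R I" "b \<in> tight_closure R I"
    then obtain c e0 d e1 where
      c: "a \<in> carrier R" "c \<in> carrier R - {\<zero>}"
      "\<And>e. e \<ge> e0 \<Longrightarrow> c \<otimes> a [^] q e \<in> frobenius_power R I (q e)" and
      d: "b \<in> carrier R" "d \<in> carrier R - {\<zero>}"
      "\<And>e. e \<ge> e1 \<Longrightarrow> d \<otimes> b [^] q e \<in> frobenius_power R I (q e)"
      using tc by (metis (no_types, lifting))
    have "(c \<otimes> d) \<otimes> (a \<oplus> b) [^] q e \<in> frobenius_power R I (q e)" if e: "e \<ge> max e0 e1" for e
    proof -
      have "(a \<oplus> b) [^] q e = a [^] q e \<oplus> b [^] q e"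
        unfolding q_def
        using frobenius_add[OF ring_char_prime[OF char] ring_char_eq_zero[OF char]] c d by blast
      then have "(c \<otimes> d) \<otimes> (a \<oplus> b) [^] q e = d \<otimes> (c \<otimes> a [^] q e) \<oplus> c \<otimes> (d \<otimes> b [^] q e)"
        using c(1,2) d(1,2) by (simp add: r_distr m_ac)
      moreover have "d \<otimes> (c \<otimes> a [^] q e) \<in> frobenius_power R I (q e)"
        "c \<otimes> (d \<otimes> b [^] q e) \<in> frobenius_power R I (q e)"
        using ideal.I_l_closed[OF F] c d e by auto
      ultimately show ?thesis
        using additive_subgroup.a_closed[OF ideal.axioms(1)[OF F]] by simp
    qed
    moreover have "c \<otimes> d \<in> carrier R - {\<zero>}" using c d integral_iff by auto
    ultimately have "\<exists>c\<in>carrier R - {\<zero>}. \<exists>e0. \<forall>e\<ge>e0.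
        c \<otimes> (a \<oplus> b) [^] q e \<in> frobenius_power R I (q e)"
      by (intro bexI[of _ "c \<otimes> d"] exI[of _ "max e0 e1"]) simp_all
    then show "a \<oplus> b \<in> tight_closure R I"
      unfolding tc using c(1) d(1) by simp
  qed
  fix a r assume a: "a \<in> tight_closure R I" and r: "r \<in> carrier R"
  then show "r \<otimes> a \<in> tight_closure R I" by (intro mult)
  then show "a \<otimes> r \<in> tight_closure R I" using a r by (simp add: tc m_comm)
qed

end

section \<open>The star-hull as a dual of the star-core\<close>

context residue_hull
begin

abbreviation dual :: "'r set \<Rightarrow> 'e set" where
  "dual K \<equiv> module_colon E {\<zero>\<^bsub>E\<^esub>} K"

lemma dual_submodule: "ideal K R \<Longrightarrow> submodule (dual K) R E"
  by (intro submodule_colon[OF zero_submodule] subsetI) (rule ideal.Icarr)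

text \<open>\<open>\<C>\<close> is the family of submodules whose sum is the star-hull. Passing to annihilators turns its
  members into star-reductions of \<open>I\<close>, and conversely every star-reduction is the annihilator of a
  member, so the two families correspond to each other.\<close>
lemma star_hull_eq_dual_star_core:
  assumes "domain R" and char: "ring_char R > 0" and I: "ideal I R"
  shows "star_hull R E (dual I) = dual (star_core R I)"
proof -
  define \<C> where "\<C> = {C. submodule C R E \<and> dual I \<subseteq> C \<and>
    star_interior R E C = star_interior R E (dual I)}"
  have tight: "ideal (tight_closure R K) R" if "ideal K R" for K
    using domain.tight_closure_ideal[OF assms(1) char that] .
  have reduction_annihilator: "star_reduction R I (annihilator R E C)" if "C \<in> \<C>" for C
  proof -
    have C: "submodule C R E" "dual I \<subseteq> C"
      and interior: "star_interior R E C = star_interior R E (dual I)"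
      using that by (auto simp: \<C>_def)
    have ann: "ideal (annihilator R E C) R"
      using ideal_annihilator submoduleE(1)[OF C(1)] by blast
    \<comment> \<open>Taking annihilators of both sides recovers the tight closures, since they are ideals.\<close>
    have "dual (tight_closure R (annihilator R E C)) = dual (tight_closure R I)"
      using interior by (simp add: star_interior_def annihilator_colon[OF I])
    then have "tight_closure R (annihilator R E C) = tight_closure R I"
      using annihilator_colon tight[OF ann] tight[OF I] by metis
    moreover have "annihilator R E C \<subseteq> I"
      using annihilator_antimono[OF C(2)] by (simp add: annihilator_colon[OF I])
    ultimately show ?thesis using ann by (simp add: star_reduction_def)
  qed
  have dual_reduction: "dual K \<in> \<C>" if "star_reduction R I K" for K
  proof -
    have K: "ideal K R" "K \<subseteq> I" "tight_closure R K = tight_closure R I"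
      using that by (auto simp: star_reduction_def)
    then show ?thesis
      using dual_submodule colon_antimono
      by (simp add: \<C>_def star_interior_def annihilator_colon I)
  qed
  have C_carrier: "\<Union>\<C> \<subseteq> carrier E" using submoduleE(1) by (auto simp: \<C>_def)
  define H where "H = gen_submodule R E (\<Union>\<C>)"
  have H: "submodule H R E" unfolding H_def by (rule submodule_gen_submodule[OF C_carrier])
  have "I \<in> {K. star_reduction R I K}" using I by (simp add: star_reduction_def)
  then have core_I: "star_core R I \<subseteq> I" unfolding star_core_def by blast
  have core_carrier: "star_core R I \<subseteq> carrier R" using core_I ideal.Icarr[OF I] by blast
  have "H \<subseteq> dual (star_core R I)"
    unfolding H_def
  proof (rule gen_submodule_subset)
    show "submodule (dual (star_core R I)) R E"
      using submodule_colon[OF zero_submodule core_carrier] .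
    have "C \<subseteq> dual (star_core R I)" if C: "C \<in> \<C>" for C
    proof -
      have "star_core R I \<subseteq> annihilator R E C"
        using reduction_annihilator[OF C] by (auto simp: star_core_def)
      then have "dual (annihilator R E C) \<subseteq> dual (star_core R I)" by (rule colon_antimono)
      then show ?thesis using C colon_annihilator by (auto simp: \<C>_def)
    qed
    then show "\<Union>\<C> \<subseteq> dual (star_core R I)" by blast
  qed
  moreover have "annihilator R E H \<subseteq> star_core R I"
  proof -
    have "annihilator R E H \<subseteq> K" if K: "star_reduction R I K" for K
    proof -
      have "dual K \<subseteq> H"
        using dual_reduction[OF K] subset_gen_submodule[of "\<Union>\<C>"] by (auto simp: H_def)
      then have "annihilator R E H \<subseteq> annihilator R E (dual K)" by (rule annihilator_antimono)
      then show ?thesis using K by (simp add: star_reduction_def annihilator_colon)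
    qed
    then show ?thesis by (auto simp: star_core_def)
  qed
  then have "dual (star_core R I) \<subseteq> H"
    using colon_antimono[of "annihilator R E H"] colon_annihilator[OF H] by blast
  ultimately show ?thesis by (simp add: star_hull_def \<C>_def H_def)
qed

text \<open>An element \<open>r\<close> kills \<open>I (0 :\<^sub>E J)\<close> iff \<open>r I \<subseteq> (0 :\<^sub>R (0 :\<^sub>E J)) = J\<close>. So both sides have the same
  annihilator, and submodules of \<open>E\<close> are determined by theirs.\<close>
lemma dual_ideal_colon:
  assumes J: "ideal J R" and I: "ideal I R"
  shows "dual (ideal_colon R J I) = ideal_smult R E I (dual J)"
proof -
  define S where "S = {a \<odot>\<^bsub>E\<^esub> x | a x. a \<in> I \<and> x \<in> dual J}"
  have S: "S \<subseteq> carrier E" using ideal.Icarr[OF I] by (auto simp: S_def module_colon_def)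
  note G = submodule_gen_submodule[OF S]
  have "annihilator R E (gen_submodule R E S) = annihilator R E S"
  proof
    show "annihilator R E (gen_submodule R E S) \<subseteq> annihilator R E S"
      by (rule annihilator_antimono[OF subset_gen_submodule])
    have "gen_submodule R E S \<subseteq> dual (annihilator R E S)"
      using S by (intro gen_submodule_subset dual_submodule ideal_annihilator)
        (auto simp: module_colon_def annihilator_def)
    then show "annihilator R E S \<subseteq> annihilator R E (gen_submodule R E S)"
      by (auto simp: module_colon_def annihilator_def)
  qed
  also have "\<dots> = ideal_colon R J I"
  proof -
    have "r \<in> annihilator R E S \<longleftrightarrow> (\<forall>a\<in>I. a \<otimes> r \<in> J)" if r: "r \<in> carrier R" for r
    proof -
      have "r \<in> annihilator R E S \<longleftrightarrow> (\<forall>a\<in>I. \<forall>x\<in>dual J. r \<odot>\<^bsub>E\<^esub> (a \<odot>\<^bsub>E\<^esub> x) = \<zero>\<^bsub>E\<^esub>)"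
        using r by (auto simp: annihilator_def S_def)
      also have "\<dots> \<longleftrightarrow> (\<forall>a\<in>I. a \<otimes> r \<in> annihilator R E (dual J))"
      proof (rule ball_cong[OF refl])
        fix a assume "a \<in> I"
        then have a: "a \<in> carrier R" using ideal.Icarr[OF I] by blast
        have "r \<odot>\<^bsub>E\<^esub> (a \<odot>\<^bsub>E\<^esub> x) = (a \<otimes> r) \<odot>\<^bsub>E\<^esub> x" if "x \<in> dual J" for x
          using that a r by (simp add: module_colon_def R.m_comm flip: smult_assoc1)
        then show "(\<forall>x\<in>dual J. r \<odot>\<^bsub>E\<^esub> (a \<odot>\<^bsub>E\<^esub> x) = \<zero>\<^bsub>E\<^esub>) \<longleftrightarrow> a \<otimes> r \<in> annihilator R E (dual J)"
          using a r by (simp add: annihilator_def)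
      qed
      finally show ?thesis by (simp add: annihilator_colon[OF J])
    qed
    moreover have "annihilator R E S \<subseteq> carrier R" by (auto simp: annihilator_def)
    ultimately show ?thesis by (auto simp: ideal_colon_def)
  qed
  finally show ?thesis
    using colon_annihilator[OF G] by (simp add: ideal_smult_def S_def)
qed

end

theorem theorem7p14:
  fixes R :: "('r, 'm) ring_scheme" and E :: "('r, 'e, 'n) module_scheme"
    and \<mm> I J :: "'r set"
  assumes "local_ring R \<mm>"
    and "noetherian_ring R"
    and "normal_domain R"
    and "adically_complete R \<mm>"
    and "ring_char R > 0"
    and "injective_hull R (quot_module R \<mm>) E"
    and "ideal I R"
    and "star_reduction R I J"
    and "star_core R I = I \<cdot>\<^bsub>R\<^esub> (ideal_colon R J I)"
  shows "star_hull R E (module_colon E {\<zero>\<^bsub>E\<^esub>} I) =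
           module_colon E (ideal_smult R E I (module_colon E {\<zero>\<^bsub>E\<^esub>} J)) I
       \<and> star_hull R E (module_colon E {\<zero>\<^bsub>E\<^esub>} I) =
           basically_full_closure R E I (module_colon E {\<zero>\<^bsub>E\<^esub>} J)"
proof -
  obtain u where "residue_hull R E \<mm> u"
    using residue_hull_of_injective_hull assms(1,2,4,6) by blast
  then interpret residue_hull R E \<mm> u .
  have "domain R" using assms(3) by (simp add: normal_domain_def)
  have J: "ideal J R" using assms(8) by (simp add: star_reduction_def)
  have "star_hull R E (dual I) = dual (I \<cdot>\<^bsub>R\<^esub> (ideal_colon R J I))"
    using star_hull_eq_dual_star_core[OF \<open>domain R\<close> assms(5,7)] by (simp add: assms(9))
  also have "\<dots> = module_colon E (dual (ideal_colon R J I)) I"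
    by (rule colon_ideal_prod[OF assms(7) R.ideal_ideal_colon[OF J assms(7)]])
  also have "\<dots> = module_colon E (ideal_smult R E I (dual J)) I"
    by (simp add: dual_ideal_colon[OF J assms(7)])
  finally show ?thesis by (simp add: basically_full_closure_def)
qed

end
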